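(* Let $(\mathcal{U},\sigma,D)$ be a (saturated) model of DCFA and $n\ge 1$. No infinite definable subgroup of $\mathbb{G}_a^n(\mathcal{U})$ is $1$-based.
   Context: DCFA is the model companion of the theory of difference-differential fields $(K,\sigma,D)$ of characteristic zero ($D$ a derivation, $\sigma$ a field automorphism commuting with $D$). "Definable" means definable with parameters in the language $\mathcal{L}_{\sigma,D}$ of difference-differential fields. $\mathbb{G}_a$ is the additive group. $\mathrm{acl}(A)$ is the field-theoretic algebraic closure of the difference-differential field (closed under $\sigma,\sigma^{-1},D$) generated by $A$; independence (non-forking) of $A$ and $B$ over $C$ means linear disjointness of $\mathrm{acl}(AC)$ and $\mathrm{acl}(BC)$ over $\mathrm{acl}(C)$. A set $S$ that is $(\infty)$-definable over $A$ is $1$-based if for every tuple $a$ of elements of $S$ and every $B\supseteq A$, $a$ and $B$ are independent over $\mathrm{acl}(Aa)\cap\mathrm{acl}(B)$. *)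

theory Defs
  imports
    "HOL-Algebra.Finite_Extensions"
    "HOL-Algebra.QuotRing"
    "HOL-Algebra.Product_Groups"
    "HOL-Library.Equipollence"
begin

section \<open>Structures for the language \<open>{0, 1, +, \<cdot>, -, \<sigma>, D}\<close>\<close>

text \<open>The symbol \<open>-\<close> has its own record field because HOL-Algebra's \<open>\<ominus>\<close> is a derived operation that
  makes sense only in rings, whereas an arbitrary structure for the language need not be a ring.\<close>

record 'a dd_struct = "'a ring" +
  opp :: "'a \<Rightarrow> 'a"
  shift :: "'a \<Rightarrow> 'a"
  der :: "'a \<Rightarrow> 'a"

definition dd_structure :: "'a dd_struct \<Rightarrow> bool" where
  "dd_structure M \<longleftrightarrow>
     \<zero>\<^bsub>M\<^esub> \<in> carrier M \<and> \<one>\<^bsub>M\<^esub> \<in> carrier M \<and>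
     (\<forall>x\<in>carrier M. \<forall>y\<in>carrier M. x \<oplus>\<^bsub>M\<^esub> y \<in> carrier M \<and> x \<otimes>\<^bsub>M\<^esub> y \<in> carrier M) \<and>
     (\<forall>x\<in>carrier M. opp M x \<in> carrier M \<and> shift M x \<in> carrier M \<and> der M x \<in> carrier M)"

datatype tm = Var nat | Zero | One | Add tm tm | Mult tm tm | Opp tm | Shift tm | Der tm

datatype fm = Eq tm tm | Neg fm | Conj fm fm | Ex nat fm

primrec tm_val :: "'a dd_struct \<Rightarrow> (nat \<Rightarrow> 'a) \<Rightarrow> tm \<Rightarrow> 'a" where
  "tm_val M e (Var i) = e i"
| "tm_val M e Zero = \<zero>\<^bsub>M\<^esub>"
| "tm_val M e One = \<one>\<^bsub>M\<^esub>"
| "tm_val M e (Add s t) = tm_val M e s \<oplus>\<^bsub>M\<^esub> tm_val M e t"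
| "tm_val M e (Mult s t) = tm_val M e s \<otimes>\<^bsub>M\<^esub> tm_val M e t"
| "tm_val M e (Opp t) = opp M (tm_val M e t)"
| "tm_val M e (Shift t) = shift M (tm_val M e t)"
| "tm_val M e (Der t) = der M (tm_val M e t)"

primrec sat :: "'a dd_struct \<Rightarrow> (nat \<Rightarrow> 'a) \<Rightarrow> fm \<Rightarrow> bool" where
  "sat M e (Eq s t) \<longleftrightarrow> tm_val M e s = tm_val M e t"
| "sat M e (Neg p) \<longleftrightarrow> \<not> sat M e p"
| "sat M e (Conj p q) \<longleftrightarrow> sat M e p \<and> sat M e q"
| "sat M e (Ex i p) \<longleftrightarrow> (\<exists>x\<in>carrier M. sat M (e(i := x)) p)"

primrec tm_vars :: "tm \<Rightarrow> nat set" where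
  "tm_vars (Var i) = {i}"
| "tm_vars Zero = {}"
| "tm_vars One = {}"
| "tm_vars (Add s t) = tm_vars s \<union> tm_vars t"
| "tm_vars (Mult s t) = tm_vars s \<union> tm_vars t"
| "tm_vars (Opp t) = tm_vars t"
| "tm_vars (Shift t) = tm_vars t"
| "tm_vars (Der t) = tm_vars t"

primrec free_vars :: "fm \<Rightarrow> nat set" where
  "free_vars (Eq s t) = tm_vars s \<union> tm_vars t"
| "free_vars (Neg p) = free_vars p"
| "free_vars (Conj p q) = free_vars p \<union> free_vars q"
| "free_vars (Ex i p) = free_vars p - {i}"

definition is_theory :: "fm set \<Rightarrow> bool" where
  "is_theory T \<longleftrightarrow> (\<forall>p\<in>T. free_vars p = {})"

definition models :: "'a dd_struct \<Rightarrow> fm set \<Rightarrow> bool" where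
  "models M T \<longleftrightarrow> dd_structure M \<and> (\<forall>p\<in>T. \<forall>e. range e \<subseteq> carrier M \<longrightarrow> sat M e p)"

definition embedding :: "('a \<Rightarrow> 'b) \<Rightarrow> 'a dd_struct \<Rightarrow> 'b dd_struct \<Rightarrow> bool" where
  "embedding f M N \<longleftrightarrow>
     f \<in> carrier M \<rightarrow> carrier N \<and> inj_on f (carrier M) \<and>
     f \<zero>\<^bsub>M\<^esub> = \<zero>\<^bsub>N\<^esub> \<and> f \<one>\<^bsub>M\<^esub> = \<one>\<^bsub>N\<^esub> \<and>
     (\<forall>x\<in>carrier M. \<forall>y\<in>carrier M.
        f (x \<oplus>\<^bsub>M\<^esub> y) = f x \<oplus>\<^bsub>N\<^esub> f y \<and> f (x \<otimes>\<^bsub>M\<^esub> y) = f x \<otimes>\<^bsub>N\<^esub> f y) \<and>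
     (\<forall>x\<in>carrier M.
        f (opp M x) = opp N (f x) \<and> f (shift M x) = shift N (f x) \<and> f (der M x) = der N (f x))"

definition elementary :: "('a \<Rightarrow> 'b) \<Rightarrow> 'a dd_struct \<Rightarrow> 'b dd_struct \<Rightarrow> bool" where
  "elementary f M N \<longleftrightarrow>
     (\<forall>p e. range e \<subseteq> carrier M \<longrightarrow> sat M e p = sat N (f \<circ> e) p)"

text \<open>All structures below have their carrier inside one type \<open>'a\<close>. As the language is countable,
  by Loewenheim-Skolem and compactness the following does not depend on the choice of the infinite
  type \<open>'a\<close>, and says that \<open>T\<close> is a model companion of the theory with class of models \<open>K\<close>.\<close>

definition model_companion :: "('a dd_struct \<Rightarrow> bool) \<Rightarrow> fm set \<Rightarrow> bool" where
  "model_companion K T \<longleftrightarrow>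
     is_theory T \<and>
     (\<forall>M. K M \<longrightarrow> (\<exists>N :: 'a dd_struct. models N T \<and> (\<exists>f. embedding f M N))) \<and>
     (\<forall>M :: 'a dd_struct. models M T \<longrightarrow> (\<exists>N. K N \<and> (\<exists>f. embedding f M N))) \<and>
     (\<forall>(M :: 'a dd_struct) (N :: 'a dd_struct) f.
        models M T \<and> models N T \<and> embedding f M N \<longrightarrow> elementary f M N)"


section \<open>Difference-differential fields and DCFA\<close>

definition dd_field :: "'a dd_struct \<Rightarrow> bool" where
  "dd_field M \<longleftrightarrow>
     field M \<and> (\<forall>m::nat. m > 0 \<longrightarrow> [m] \<cdot>\<^bsub>M\<^esub> \<one>\<^bsub>M\<^esub> \<noteq> \<zero>\<^bsub>M\<^esub>) \<and>
     (\<forall>x\<in>carrier M. opp M x = \<ominus>\<^bsub>M\<^esub> x) \<and>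
     shift M \<in> ring_iso M M \<and>
     der M \<in> carrier M \<rightarrow> carrier M \<and>
     (\<forall>x\<in>carrier M. \<forall>y\<in>carrier M.
        der M (x \<oplus>\<^bsub>M\<^esub> y) = der M x \<oplus>\<^bsub>M\<^esub> der M y \<and>
        der M (x \<otimes>\<^bsub>M\<^esub> y) = der M x \<otimes>\<^bsub>M\<^esub> y \<oplus>\<^bsub>M\<^esub> x \<otimes>\<^bsub>M\<^esub> der M y) \<and>
     (\<forall>x\<in>carrier M. shift M (der M x) = der M (shift M x))"

definition DCFA_model :: "'a dd_struct \<Rightarrow> bool" where
  "DCFA_model U \<longleftrightarrow> (\<exists>T. model_companion (dd_field :: 'a dd_struct \<Rightarrow> bool) T \<and> models U T)"


section \<open>Saturation and definable sets\<close>

definition small :: "'a dd_struct \<Rightarrow> 'a set \<Rightarrow> bool" where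
  "small U A \<longleftrightarrow> A \<subseteq> carrier U \<and> A \<prec> carrier U"

text \<open>A set of formulas in the variable \<open>0\<close> with parameters is a set of pairs \<open>(p, e)\<close>, where \<open>e\<close>
  gives the parameters that replace the other free variables of \<open>p\<close>.\<close>

definition realizes :: "'a dd_struct \<Rightarrow> 'a \<Rightarrow> (fm \<times> (nat \<Rightarrow> 'a)) set \<Rightarrow> bool" where
  "realizes U x P \<longleftrightarrow> x \<in> carrier U \<and> (\<forall>(p, e)\<in>P. sat U (e(0 := x)) p)"

definition saturated :: "'a dd_struct \<Rightarrow> bool" where
  "saturated U \<longleftrightarrow>
     (\<forall>A P. small U A \<and> (\<forall>(p, e)\<in>P. \<forall>i\<in>free_vars p - {0}. e i \<in> A) \<and>
            (\<forall>Q. finite Q \<and> Q \<subseteq> P \<longrightarrow> (\<exists>x. realizes U x Q)) \<longrightarrow>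
        (\<exists>x. realizes U x P))"

text \<open>The \<open>n\<close>-tuples are the extensional functions on \<open>{..<n}\<close>; the free variables \<open>\<ge> n\<close> of the
  defining formula are replaced by the parameters.\<close>

definition definable_over :: "'a dd_struct \<Rightarrow> nat \<Rightarrow> 'a set \<Rightarrow> (nat \<Rightarrow> 'a) set \<Rightarrow> bool" where
  "definable_over U n A S \<longleftrightarrow>
     (\<exists>p e. (\<forall>i\<in>free_vars p. i \<ge> n \<longrightarrow> e i \<in> A) \<and>
        S = {x \<in> (\<Pi>\<^sub>E i\<in>{..<n}. carrier U). sat U (\<lambda>i. if i < n then x i else e i) p})"

definition Ga :: "'a dd_struct \<Rightarrow> nat \<Rightarrow> (nat \<Rightarrow> 'a) monoid" where
  "Ga U n = product_group {..<n} (\<lambda>_. add_monoid U)"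


section \<open>Algebraic closure, independence and 1-basedness\<close>

definition dd_generated :: "'a dd_struct \<Rightarrow> 'a set \<Rightarrow> 'a set" where
  "dd_generated U A =
     \<Inter>{K. subfield K U \<and> A \<subseteq> K \<and> shift U ` K = K \<and> der U ` K \<subseteq> K}"

definition acl :: "'a dd_struct \<Rightarrow> 'a set \<Rightarrow> 'a set" where
  "acl U A = {x \<in> carrier U. ring.algebraic U (dd_generated U A) x}"

definition linearly_disjoint :: "'a dd_struct \<Rightarrow> 'a set \<Rightarrow> 'a set \<Rightarrow> 'a set \<Rightarrow> bool" where
  "linearly_disjoint U C K L \<longleftrightarrow>
     (\<forall>xs. set xs \<subseteq> K \<and> ring.independent U C xs \<longrightarrow> ring.independent U L xs)"

definition indep_over :: "'a dd_struct \<Rightarrow> 'a set \<Rightarrow> 'a set \<Rightarrow> 'a set \<Rightarrow> bool" where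
  "indep_over U C A B \<longleftrightarrow> linearly_disjoint U (acl U C) (acl U (A \<union> C)) (acl U (B \<union> C))"

text \<open>A tuple of elements of \<open>S\<close> enters only through the finite set of its coordinates. As usual in a
  saturated model, the parameter sets are small.\<close>

definition coords :: "nat \<Rightarrow> (nat \<Rightarrow> 'a) list \<Rightarrow> 'a set" where
  "coords n as = (\<Union>x\<in>set as. x ` {..<n})"

definition one_based :: "'a dd_struct \<Rightarrow> nat \<Rightarrow> 'a set \<Rightarrow> (nat \<Rightarrow> 'a) set \<Rightarrow> bool" where
  "one_based U n A S \<longleftrightarrow>
     (\<forall>as B. set as \<subseteq> S \<and> A \<subseteq> B \<and> small U B \<longrightarrow>
        indep_over U (acl U (A \<union> coords n as) \<inter> acl U B) (coords n as) B)"

end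

theory Submission
  imports Defs
begin

text \<open>If \<open>x\<close> and \<open>y\<close> are the \<open>k\<close>-th coordinates of \<open>a, b \<in> G\<close>, the point \<open>(x, y)\<close> lies on the
  line \<open>y + l x = c\<close>, and 1-basedness over \<open>B = A \<union> {l, c}\<close> forces \<open>l \<in> acl(A a b)\<close> or
  \<open>x \<in> acl(A l c)\<close>. To avoid both, \<open>l\<close> is chosen as a nonstandard natural number: by saturation it
  suffices that \<open>x \<notin> acl(A, y + m x)\<close> for every natural number \<open>m\<close>. Such \<open>x\<close>, \<open>y\<close> exist by
  compactness, because for \<open>g \<noteq> 0\<close> the grid of the points \<open>(j g, j' g)\<close> is not covered by finitely
  many sets each of which meets the lines of one slope in a bounded number of points.\<close>

section \<open>Coincidence and substitution\<close>

text \<open>A subgroup is closed under integer combinations only, so the counting argument must use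
  integer multiples of \<open>g\<close> and integer slopes. An integer, however, lies in every
  algebraic closure and cannot be the slope that contradicts 1-basedness. Saturation bridges the
  two: a slope outside the closure of the data is found that keeps the independence valid at every
  natural number.

  Saturation needs conditions given by first-order formulas, whereas \<open>acl\<close> is built
  from generated fields. The intermediate notion \<open>macl\<close>, made of the solutions of
  formulas with uniformly bounded fibres, contains \<open>acl\<close>, and its complement is an
  intersection of definable sets even when a parameter varies. Genericity is therefore established
  for \<open>macl\<close>, where it is the stronger statement.\<close>

lemma finite_tm_vars: "finite (tm_vars t)"
  by (induction t) auto

lemma finite_free_vars: "finite (free_vars p)"
  by (induction p) (auto simp: finite_tm_vars)

lemma tm_val_cong: "(\<And>i. i \<in> tm_vars t \<Longrightarrow> e i = e' i) \<Longrightarrow> tm_val M e t = tm_val M e' t"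
  by (induction t) auto

lemma sat_cong: "(\<And>i. i \<in> free_vars p \<Longrightarrow> e i = e' i) \<Longrightarrow> sat M e p \<longleftrightarrow> sat M e' p"
proof (induction p arbitrary: e e')
  case (Eq s t)
  then show ?case
    using tm_val_cong[of s e e' M] tm_val_cong[of t e e' M] by auto
next
  case (Ex i p)
  have "sat M (e(i := x)) p \<longleftrightarrow> sat M (e'(i := x)) p" for x
    using Ex.prems by (intro Ex.IH) auto
  then show ?case by simp
next
  case (Neg p)
  then show ?case by (metis free_vars.simps(2) sat.simps(2))
next
  case (Conj p q)
  then show ?case by (metis UnCI free_vars.simps(3) sat.simps(3))
qed

primrec tm_subst :: "(nat \<Rightarrow> tm) \<Rightarrow> tm \<Rightarrow> tm" where
  "tm_subst s (Var i) = s i"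
| "tm_subst s Zero = Zero"
| "tm_subst s One = One"
| "tm_subst s (Add t u) = Add (tm_subst s t) (tm_subst s u)"
| "tm_subst s (Mult t u) = Mult (tm_subst s t) (tm_subst s u)"
| "tm_subst s (Opp t) = Opp (tm_subst s t)"
| "tm_subst s (Shift t) = Shift (tm_subst s t)"
| "tm_subst s (Der t) = Der (tm_subst s t)"

definition fresh :: "nat set \<Rightarrow> nat" where
  "fresh V = (SOME j. j \<notin> V)"

lemma fresh: "finite V \<Longrightarrow> fresh V \<notin> V"
  unfolding fresh_def using ex_new_if_finite[OF infinite_UNIV_nat] by (metis someI_ex)

text \<open>The bound variable is renamed at every quantifier, so that no substituted term is
  captured. This permits moving the arguments and parameters of a formula to other
  variables.\<close>

primrec fm_subst :: "fm \<Rightarrow> (nat \<Rightarrow> tm) \<Rightarrow> fm" where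
  "fm_subst (Eq t u) s = Eq (tm_subst s t) (tm_subst s u)"
| "fm_subst (Neg p) s = Neg (fm_subst p s)"
| "fm_subst (Conj p q) s = Conj (fm_subst p s) (fm_subst q s)"
| "fm_subst (Ex i p) s =
     (let j = fresh (\<Union>k\<in>free_vars p - {i}. tm_vars (s k)) in Ex j (fm_subst p (s(i := Var j))))"

lemma tm_val_subst: "tm_val M e (tm_subst s t) = tm_val M (\<lambda>i. tm_val M e (s i)) t"
  by (induction t) auto

lemma tm_vars_subst: "tm_vars (tm_subst s t) = (\<Union>i\<in>tm_vars t. tm_vars (s i))"
  by (induction t) auto

lemma free_vars_subst: "free_vars (fm_subst p s) \<subseteq> (\<Union>i\<in>free_vars p. tm_vars (s i))"
proof (induction p arbitrary: s)
  case (Ex i p)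
  define j where "j = fresh (\<Union>k\<in>free_vars p - {i}. tm_vars (s k))"
  have "free_vars (fm_subst p (s(i := Var j))) - {j} \<subseteq> (\<Union>k\<in>free_vars p - {i}. tm_vars (s k))"
  proof
    fix x assume "x \<in> free_vars (fm_subst p (s(i := Var j))) - {j}"
    then obtain k where "k \<in> free_vars p" "x \<in> tm_vars ((s(i := Var j)) k)" "x \<noteq> j"
      using Ex[of "s(i := Var j)"] by blast
    then show "x \<in> (\<Union>k\<in>free_vars p - {i}. tm_vars (s k))"
      by (cases "k = i") auto
  qed
  then show ?case
    by (simp add: j_def Let_def)
qed (auto simp: tm_vars_subst, blast+)

lemma sat_subst: "sat M e (fm_subst p s) \<longleftrightarrow> sat M (\<lambda>i. tm_val M e (s i)) p"
proof (induction p arbitrary: s e)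
  case (Ex i p)
  define V where "V = (\<Union>k\<in>free_vars p - {i}. tm_vars (s k))"
  have "fresh V \<notin> V"
    by (intro fresh) (auto simp: V_def finite_free_vars finite_tm_vars)
  then have "sat M (\<lambda>k. tm_val M (e(fresh V := x)) ((s(i := Var (fresh V))) k)) p \<longleftrightarrow>
      sat M ((\<lambda>k. tm_val M e (s k))(i := x)) p" for x
    by (intro sat_cong) (auto simp: V_def intro!: tm_val_cong)
  then show ?case
    by (simp add: Ex.IH V_def[symmetric] Let_def del: fun_upd_apply)
qed (auto simp: tm_val_subst)

lemma sat_Exs:
  "sat M e (foldr Ex is p) \<longleftrightarrow>
     (\<exists>v. (\<forall>i\<in>set is. v i \<in> carrier M) \<and> sat M (\<lambda>i. if i \<in> set is then v i else e i) p)"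
proof (induction "is" arbitrary: e)
  case (Cons j js)
  \<comment> \<open>A further occurrence of \<open>j\<close> in \<open>js\<close> is harmless: the
    inner quantifier overrides the outer one.\<close>
  have eq: "(\<lambda>i. if i \<in> set js then v i else (e(j := x)) i) =
     (\<lambda>i. if i \<in> set (j # js) then (if i \<in> set js then v i else x) else e i)" for v x
    by auto
  have eq': "(\<lambda>i. if i \<in> set js then v i else (e(j := v j)) i) =
     (\<lambda>i. if i \<in> set (j # js) then v i else e i)" for v
    by auto
  show ?case (is "?l \<longleftrightarrow> ?r")
  proof
    assume ?l
    then obtain x v where "x \<in> carrier M" "\<forall>i\<in>set js. v i \<in> carrier M"
      "sat M (\<lambda>i. if i \<in> set js then v i else (e(j := x)) i) p"
      using Cons.IH by auto
    then show ?r
      unfolding eq by (intro exI[of _ "\<lambda>i. if i \<in> set js then v i else x"]) auto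
  next
    assume ?r
    then obtain v where "\<forall>i\<in>set (j # js). v i \<in> carrier M"
      "sat M (\<lambda>i. if i \<in> set js then v i else (e(j := v j)) i) p"
      unfolding eq'[symmetric] by blast
    then have "v j \<in> carrier M" "sat M (e(j := v j)) (foldr Ex js p)"
      unfolding Cons.IH[of "e(j := v j)"] by auto
    then show ?l by auto
  qed
qed simp

lemma free_vars_Exs: "free_vars (foldr Ex is p) = free_vars p - set is"
  by (induction "is") auto


section \<open>Difference-differential fields\<close>

text \<open>Universal axioms are pulled back along the injective \<open>f\<close>. With a symbol for
  negatives these include the additive group laws; inverses and surjectivity of the shift are
  existential, hence the hypotheses \<open>inv\<close> and \<open>surj\<close>.\<close>

lemma embedding_dd_field:
  assumes K: "dd_field N" and f: "embedding f M N" and M: "dd_structure M"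
    and inv: "\<And>x. x \<in> carrier M \<Longrightarrow> x \<noteq> \<zero>\<^bsub>M\<^esub> \<Longrightarrow> \<exists>y\<in>carrier M. x \<otimes>\<^bsub>M\<^esub> y = \<one>\<^bsub>M\<^esub>"
    and surj: "\<And>x. x \<in> carrier M \<Longrightarrow> \<exists>y\<in>carrier M. shift M y = x"
  shows "dd_field M"
proof -
  interpret N: field N using K by (simp add: dd_field_def)
  have cl: "\<zero>\<^bsub>M\<^esub> \<in> carrier M" "\<one>\<^bsub>M\<^esub> \<in> carrier M"
    "\<And>x y. x \<in> carrier M \<Longrightarrow> y \<in> carrier M \<Longrightarrow> x \<oplus>\<^bsub>M\<^esub> y \<in> carrier M"
    "\<And>x y. x \<in> carrier M \<Longrightarrow> y \<in> carrier M \<Longrightarrow> x \<otimes>\<^bsub>M\<^esub> y \<in> carrier M"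
    "\<And>x. x \<in> carrier M \<Longrightarrow> opp M x \<in> carrier M"
    "\<And>x. x \<in> carrier M \<Longrightarrow> shift M x \<in> carrier M"
    "\<And>x. x \<in> carrier M \<Longrightarrow> der M x \<in> carrier M"
    using M by (auto simp: dd_structure_def)
  have fc: "x \<in> carrier M \<Longrightarrow> f x \<in> carrier N" for x
    using f by (auto simp: embedding_def)
  have inj: "f x = f y \<Longrightarrow> x \<in> carrier M \<Longrightarrow> y \<in> carrier M \<Longrightarrow> x = y" for x y
    using f by (auto simp: embedding_def inj_on_def)
  have h: "f \<zero>\<^bsub>M\<^esub> = \<zero>\<^bsub>N\<^esub>" "f \<one>\<^bsub>M\<^esub> = \<one>\<^bsub>N\<^esub>"
    "\<And>x y. x \<in> carrier M \<Longrightarrow> y \<in> carrier M \<Longrightarrow> f (x \<oplus>\<^bsub>M\<^esub> y) = f x \<oplus>\<^bsub>N\<^esub> f y"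
    "\<And>x y. x \<in> carrier M \<Longrightarrow> y \<in> carrier M \<Longrightarrow> f (x \<otimes>\<^bsub>M\<^esub> y) = f x \<otimes>\<^bsub>N\<^esub> f y"
    "\<And>x. x \<in> carrier M \<Longrightarrow> f (opp M x) = opp N (f x)"
    "\<And>x. x \<in> carrier M \<Longrightarrow> f (shift M x) = shift N (f x)"
    "\<And>x. x \<in> carrier M \<Longrightarrow> f (der M x) = der N (f x)"
    using f by (auto simp: embedding_def)
  have oppN: "opp N x = \<ominus>\<^bsub>N\<^esub> x" if "x \<in> carrier N" for x
    using K that by (simp add: dd_field_def)
  have shiftN: "shift N \<in> ring_iso N N" using K by (simp add: dd_field_def)
  have derN: "\<And>x y. x \<in> carrier N \<Longrightarrow> y \<in> carrier N \<Longrightarrow> der N (x \<oplus>\<^bsub>N\<^esub> y) = der N x \<oplus>\<^bsub>N\<^esub> der N y"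
    "\<And>x y. x \<in> carrier N \<Longrightarrow> y \<in> carrier N \<Longrightarrow>
       der N (x \<otimes>\<^bsub>N\<^esub> y) = der N x \<otimes>\<^bsub>N\<^esub> y \<oplus>\<^bsub>N\<^esub> x \<otimes>\<^bsub>N\<^esub> der N y"
    "\<And>x. x \<in> carrier N \<Longrightarrow> shift N (der N x) = der N (shift N x)"
    using K by (auto simp: dd_field_def)
  have "abelian_group M"
  proof (rule abelian_groupI)
    fix x assume x: "x \<in> carrier M"
    show "\<exists>y\<in>carrier M. y \<oplus>\<^bsub>M\<^esub> x = \<zero>\<^bsub>M\<^esub>"
      using x by (intro bexI[of _ "opp M x"]) (auto intro!: inj simp: cl h oppN fc N.l_neg)
  qed (auto intro!: inj simp: cl h fc N.a_ac)
  moreover have "comm_monoid M"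
    by (rule comm_monoidI) (auto intro!: inj simp: cl h fc N.m_ac)
  ultimately interpret M: cring M
    by (rule cringI) (auto intro!: inj simp: cl h fc N.l_distr)
  have opp: "opp M x = \<ominus>\<^bsub>M\<^esub> x" if x: "x \<in> carrier M" for x
  proof -
    have "opp M x \<oplus>\<^bsub>M\<^esub> x = \<zero>\<^bsub>M\<^esub>"
      using x by (auto intro!: inj simp: cl h oppN fc N.l_neg)
    then show ?thesis using x cl(5) M.minus_equality by metis
  qed
  have one0: "\<one>\<^bsub>M\<^esub> \<noteq> \<zero>\<^bsub>M\<^esub>" using h(1,2) N.one_not_zero by metis
  have field: "field M"
  proof (rule M.cring_fieldI2)
    show "\<zero>\<^bsub>M\<^esub> \<noteq> \<one>\<^bsub>M\<^esub>" using one0 by simp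
  qed (use inv in auto)
  have pow: "f ([m] \<cdot>\<^bsub>M\<^esub> \<one>\<^bsub>M\<^esub>) = [m] \<cdot>\<^bsub>N\<^esub> \<one>\<^bsub>N\<^esub>" for m :: nat
    by (induction m) (auto simp: h)
  have char: "[m] \<cdot>\<^bsub>M\<^esub> \<one>\<^bsub>M\<^esub> \<noteq> \<zero>\<^bsub>M\<^esub>" if "m > 0" for m :: nat
    using pow[of m] K that h(1) unfolding dd_field_def by metis
  have injN: "inj_on (shift N) (carrier N)"
    using shiftN by (auto simp: ring_iso_def bij_betw_def)
  have homN: "shift N \<in> ring_hom N N"
    using shiftN by (auto simp: ring_iso_def)
  have iso: "shift M \<in> ring_iso M M"
  proof (rule ring_iso_memI)
    show "bij_betw (shift M) (carrier M) (carrier M)"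
      unfolding bij_betw_def
    proof
      show "inj_on (shift M) (carrier M)"
        by (rule inj_onI) (metis inj fc h(6) injN inj_on_def)
      show "shift M ` carrier M = carrier M" using surj cl by fastforce
    qed
  qed (auto intro!: inj simp: cl h fc ring_hom_add[OF homN] ring_hom_mult[OF homN] ring_hom_one[OF homN])
  show ?thesis
    unfolding dd_field_def
    by (auto simp: field opp iso char cl intro!: inj) (auto simp: h fc cl derN)
qed

text \<open>A model companion only provides an embedding of \<open>U\<close> into a
  difference-differential field \<open>N\<close>. Embedding \<open>N\<close> into a further model
  \<open>V\<close> makes the composite elementary, so an equation over \<open>U\<close> that is
  solvable in \<open>N\<close> is solvable in \<open>V\<close> and therefore in
  \<open>U\<close>.\<close>

lemma DCFA_model_dd_field:
  fixes U :: "'a dd_struct"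
  assumes "DCFA_model U"
  shows "dd_field U"
proof -
  obtain T where T: "model_companion (dd_field :: 'a dd_struct \<Rightarrow> bool) T" and U: "models U T"
    using assms unfolding DCFA_model_def by blast
  obtain N :: "'a dd_struct" and f where N: "dd_field N" and f: "embedding f U N"
    using T U unfolding model_companion_def by blast
  obtain V :: "'a dd_struct" and g where V: "models V T" and g: "embedding g N V"
    using T N unfolding model_companion_def by blast
  have emb: "embedding (g \<circ> f) U V"
    using f g unfolding embedding_def by (auto simp: inj_on_def Pi_iff)
  then have el: "elementary (g \<circ> f) U V"
    using T U V unfolding model_companion_def by blast
  interpret N: field N using N by (simp add: dd_field_def)
  have Us: "dd_structure U" using U by (simp add: models_def)
  have fN: "f x \<in> carrier N" if "x \<in> carrier U" for x
    using f that by (auto simp: embedding_def)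
  have f0: "f x \<noteq> \<zero>\<^bsub>N\<^esub>" if "x \<in> carrier U" "x \<noteq> \<zero>\<^bsub>U\<^esub>" for x
    using f that Us unfolding embedding_def inj_on_def dd_structure_def by metis
  have gV: "g x \<in> carrier V" "g (shift N x) = shift V (g x)" if "x \<in> carrier N" for x
    using g that by (auto simp: embedding_def)
  have gV': "g (x \<otimes>\<^bsub>N\<^esub> y) = g x \<otimes>\<^bsub>V\<^esub> g y" if "x \<in> carrier N" "y \<in> carrier N" for x y
    using g that by (auto simp: embedding_def)
  have g1: "g \<one>\<^bsub>N\<^esub> = \<one>\<^bsub>V\<^esub>"
    using g by (auto simp: embedding_def)
  have lift: "(\<exists>y\<in>carrier U. sat U ((\<lambda>_. x)(1 := y)) p) \<longleftrightarrow>
      (\<exists>y\<in>carrier V. sat V ((\<lambda>_. g (f x))(1 := y)) p)" if "x \<in> carrier U" for x p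
  proof -
    have "range (\<lambda>_::nat. x) \<subseteq> carrier U" using that by auto
    then have "sat U (\<lambda>_. x) (Ex 1 p) = sat V ((g \<circ> f) \<circ> (\<lambda>_. x)) (Ex 1 p)"
      using el unfolding elementary_def by blast
    then show ?thesis by (simp add: comp_def)
  qed
  show ?thesis
  proof (rule embedding_dd_field[OF N f Us])
    fix x assume x: "x \<in> carrier U" "x \<noteq> \<zero>\<^bsub>U\<^esub>"
    have i: "inv\<^bsub>N\<^esub> (f x) \<in> carrier N" "f x \<otimes>\<^bsub>N\<^esub> inv\<^bsub>N\<^esub> (f x) = \<one>\<^bsub>N\<^esub>"
      using fN f0 x N.field_Units by auto
    have "\<exists>y\<in>carrier V. g (f x) \<otimes>\<^bsub>V\<^esub> y = \<one>\<^bsub>V\<^esub>"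
      using i gV gV' g1 fN x by metis
    then show "\<exists>y\<in>carrier U. x \<otimes>\<^bsub>U\<^esub> y = \<one>\<^bsub>U\<^esub>"
      using lift[OF x(1), of "Eq (Mult (Var 0) (Var 1)) One"] by simp
  next
    fix x assume x: "x \<in> carrier U"
    have "shift N \<in> ring_iso N N" using N by (simp add: dd_field_def)
    then have "shift N ` carrier N = carrier N" by (auto simp: ring_iso_def bij_betw_def)
    then obtain y where "y \<in> carrier N" "shift N y = f x" using fN[OF x] by (metis imageE)
    then have "\<exists>y\<in>carrier V. shift V y = g (f x)" using gV by metis
    then show "\<exists>y\<in>carrier U. shift U y = x"
      using lift[OF x, of "Eq (Shift (Var 1)) (Var 0)"] by simp
  qed
qed


section \<open>The model-theoretic algebraic closure\<close>

locale dd_fld =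
  fixes U :: "'a dd_struct" (structure)
  assumes dd_field: "dd_field U"

sublocale dd_fld \<subseteq> field U
  using dd_field by (simp add: dd_field_def)

context dd_fld
begin

lemma char_0: "m > 0 \<Longrightarrow> [(m::nat)] \<cdot> \<one> \<noteq> \<zero>"
  using dd_field by (simp add: dd_field_def)

lemma opp_eq: "x \<in> carrier U \<Longrightarrow> opp U x = \<ominus> x"
  using dd_field by (simp add: dd_field_def)

lemma shift_bij: "bij_betw (shift U) (carrier U) (carrier U)"
  using dd_field by (simp add: dd_field_def ring_iso_def)

lemma shift_closed: "x \<in> carrier U \<Longrightarrow> shift U x \<in> carrier U"
  using shift_bij by (auto simp: bij_betw_def)

lemma der_closed: "x \<in> carrier U \<Longrightarrow> der U x \<in> carrier U"
  using dd_field by (auto simp: dd_field_def)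

lemma tm_val_closed:
  "(\<And>i. i \<in> tm_vars t \<Longrightarrow> e i \<in> carrier U) \<Longrightarrow> tm_val U e t \<in> carrier U"
  by (induction t) (auto simp: opp_eq shift_closed der_closed)

lemma nat_mult_inj:
  assumes x: "x \<in> carrier U" "x \<noteq> \<zero>" and eq: "[(j::nat)] \<cdot> x = [k] \<cdot> x"
  shows "j = k"
proof -
  have "False" if lt: "j < k" and eq: "[(j::nat)] \<cdot> x = [k] \<cdot> x" for j k
  proof -
    have "[k] \<cdot> x = [j] \<cdot> x \<oplus> [(k - j)] \<cdot> x"
      using add.nat_pow_mult[OF x(1), of j "k - j"] lt by simp
    then have "[(k - j)] \<cdot> x = \<zero>"
      using eq x(1) by (metis add.nat_pow_closed add.l_cancel_one')
    moreover have "[(k - j)] \<cdot> x = ([(k - j)] \<cdot> \<one>) \<otimes> x"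
      using x(1) by (simp add: add_pow_ldistr)
    ultimately show False
      using char_0[of "k - j"] lt x integral[of "[(k - j)] \<cdot> \<one>" x] by auto
  qed
  then show ?thesis using eq by (metis linorder_neqE_nat)
qed

lemma infinite_carrier: "infinite (carrier U)"
proof -
  have "inj (\<lambda>j::nat. [j] \<cdot> \<one>)"
    using nat_mult_inj[of \<one>] by (auto intro!: injI)
  then show ?thesis
    by (rule infinite_super[OF _ range_inj_infinite, rotated]) auto
qed

text \<open>Variable \<open>0\<close> is the unknown. The condition concerns the formula alone, over
  all parameters in \<open>U\<close>, so the bound survives when parameters are specialised or
  quantified away.\<close>

definition fin_fibres :: "fm \<Rightarrow> nat \<Rightarrow> bool" where
  "fin_fibres p N \<longleftrightarrow> (\<forall>w. range w \<subseteq> carrier U \<longrightarrow>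
     finite {z \<in> carrier U. sat U (w(0 := z)) p} \<and> card {z \<in> carrier U. sat U (w(0 := z)) p} \<le> N)"

text \<open>The bound on the number of solutions has to be uniform in the parameters for non-membership
  in the closure of \<open>A\<close> and a variable element to be type-definable over \<open>A\<close>.\<close>

definition macl :: "'a set \<Rightarrow> 'a set" where
  "macl S = {x \<in> carrier U. \<exists>p e N. fin_fibres p N \<and> range e \<subseteq> carrier U \<and>
     (\<forall>i\<in>free_vars p - {0}. e i \<in> S) \<and> sat U (e(0 := x)) p}"

lemma macl_carrier: "macl S \<subseteq> carrier U"
  by (auto simp: macl_def)

lemma maclI:
  "x \<in> carrier U \<Longrightarrow> fin_fibres p N \<Longrightarrow> range e \<subseteq> carrier U \<Longrightarrow>
    (\<And>i. i \<in> free_vars p \<Longrightarrow> i \<noteq> 0 \<Longrightarrow> e i \<in> S) \<Longrightarrow> sat U (e(0 := x)) p \<Longrightarrow> x \<in> macl S"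
  unfolding macl_def by blast

lemma maclE:
  assumes "x \<in> macl S"
  obtains p e N where "x \<in> carrier U" "fin_fibres p N" "range e \<subseteq> carrier U"
    "\<And>i. i \<in> free_vars p \<Longrightarrow> i \<noteq> 0 \<Longrightarrow> e i \<in> S" "sat U (e(0 := x)) p"
  using assms unfolding macl_def by blast

lemma macl_mono: "S \<subseteq> T \<Longrightarrow> macl S \<subseteq> macl T"
  unfolding macl_def by blast

lemma fin_fibresD:
  assumes "fin_fibres p N" "range w \<subseteq> carrier U"
  shows "finite {z \<in> carrier U. sat U (w(0 := z)) p}"
    and "card {z \<in> carrier U. sat U (w(0 := z)) p} \<le> N"
  using assms unfolding fin_fibres_def by auto

lemma fin_fibres_unique:
  assumes "\<And>w z z'. range w \<subseteq> carrier U \<Longrightarrow> z \<in> carrier U \<Longrightarrow> z' \<in> carrier U \<Longrightarrow>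
    sat U (w(0 := z)) p \<Longrightarrow> sat U (w(0 := z')) p \<Longrightarrow> z = z'"
  shows "fin_fibres p 1"
  unfolding fin_fibres_def
proof (intro allI impI)
  fix w :: "nat \<Rightarrow> 'a" assume w: "range w \<subseteq> carrier U"
  obtain y where sub: "{z \<in> carrier U. sat U (w(0 := z)) p} \<subseteq> {y}"
  proof (cases "\<exists>y\<in>carrier U. sat U (w(0 := y)) p")
    case True
    then obtain y where "y \<in> carrier U" "sat U (w(0 := y)) p" by blast
    then have "{z \<in> carrier U. sat U (w(0 := z)) p} \<subseteq> {y}" using assms[OF w] by blast
    then show ?thesis by (rule that)
  next
    case False
    then have "{z \<in> carrier U. sat U (w(0 := z)) p} \<subseteq> {undefined}" by blast
    then show ?thesis by (rule that)
  qed
  show "finite {z \<in> carrier U. sat U (w(0 := z)) p} \<and> card {z \<in> carrier U. sat U (w(0 := z)) p} \<le> 1"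
    using finite_subset[OF sub] card_mono[OF _ sub] by auto
qed

lemma fin_fibres_Eq:
  assumes "0 \<notin> tm_vars t"
  shows "fin_fibres (Eq (Var 0) t) 1"
proof (rule fin_fibres_unique)
  fix w :: "nat \<Rightarrow> 'a" and z z'
  have "tm_val U (w(0 := z)) t = tm_val U w t" for z
    using assms by (intro tm_val_cong) auto
  then show "sat U (w(0 := z)) (Eq (Var 0) t) \<Longrightarrow> sat U (w(0 := z')) (Eq (Var 0) t) \<Longrightarrow> z = z'"
    by simp
qed

lemma subset_macl: "S \<subseteq> carrier U \<Longrightarrow> S \<subseteq> macl S"
proof
  fix x assume S: "S \<subseteq> carrier U" and x: "x \<in> S"
  show "x \<in> macl S"
    by (rule maclI[OF _ fin_fibres_Eq[of "Var 1"], of x "\<lambda>_. x"]) (use S x in auto)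
qed

text \<open>A parameter \<open>e i\<close> in the closure of \<open>S\<close> is replaced by an existential quantifier over the
  solutions of a formula that witnesses this.\<close>

lemma macl_idem_witness:
  assumes "x \<in> carrier U" "fin_fibres p N" "range e \<subseteq> carrier U"
    "\<And>i. i \<in> free_vars p \<Longrightarrow> i \<noteq> 0 \<Longrightarrow> e i \<in> macl S" "sat U (e(0 := x)) p"
  shows "x \<in> macl S"
  using assms
proof (induction "card {i \<in> free_vars p - {0}. e i \<notin> S}" arbitrary: p e N rule: less_induct)
  case less
  show ?case
  proof (cases "\<forall>i\<in>free_vars p - {0}. e i \<in> S")
    case True
    then show ?thesis using less.prems by (intro maclI[of x p N e]) auto
  next
    case False
    then obtain i where i: "i \<in> free_vars p" "i \<noteq> 0" "e i \<notin> S" by blast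
    obtain q f N' where q: "fin_fibres q N'" "range f \<subseteq> carrier U"
      "\<And>j. j \<in> free_vars q \<Longrightarrow> j \<noteq> 0 \<Longrightarrow> f j \<in> S" "sat U (f(0 := e i)) q"
      using maclE[OF less.prems(4)[OF i(1,2)]] by metis
    \<comment> \<open>All variables of \<open>p\<close> lie below \<open>L\<close>. In
      \<open>q\<close> the unknown is renamed to \<open>i\<close> and every parameter moves up by
      \<open>L\<close>, so the parameters of the two formulas do not clash.\<close>
    define L where "L = Suc (Max (insert i (free_vars p)))"
    have L: "j < L" if "j \<in> insert i (free_vars p)" for j
      unfolding L_def by (intro le_imp_less_Suc Max_ge) (use that finite_free_vars[of p] in auto)
    have Li: "i < L" using L by blast
    define s where "s = (\<lambda>j. Var (if j = 0 then i else j + L))"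
    define q' where "q' = fm_subst q s"
    define p' where "p' = Ex i (Conj p q')"
    define e' where "e' = (\<lambda>j. if j < L then e j else f (j - L))"
    have fq': "free_vars q' \<subseteq> insert i ((\<lambda>j. j + L) ` (free_vars q - {0}))"
      unfolding q'_def using free_vars_subst[of q s] by (auto simp: s_def split: if_splits)
    have q'0: "0 \<notin> free_vars q'" using fq' i(2) by auto
    have satq': "sat U w q' \<longleftrightarrow> sat U ((\<lambda>j. w (j + L))(0 := w i)) q" for w
      unfolding q'_def sat_subst by (intro sat_cong) (auto simp: s_def)
    \<comment> \<open>For fixed parameters, \<open>q'\<close> admits at most \<open>N'\<close>
      values of variable \<open>i\<close>, and each of them leaves at most \<open>N\<close>
      solutions of \<open>p\<close>.\<close>
    have fin: "fin_fibres p' (N' * N)"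
      unfolding fin_fibres_def
    proof (intro allI impI)
      fix w :: "nat \<Rightarrow> 'a" assume w: "range w \<subseteq> carrier U"
      define D where "D = {d \<in> carrier U. sat U (w(i := d)) q'}"
      define Z where "Z = (\<lambda>d. {z \<in> carrier U. sat U ((w(i := d))(0 := z)) p})"
      have "D = {d \<in> carrier U. sat U ((\<lambda>j. w (j + L))(0 := d)) q}"
        unfolding D_def satq' using Li by (auto intro!: Collect_cong conj_cong sat_cong[THEN iffD1])
      then have D: "finite D" "card D \<le> N'"
        using fin_fibresD[OF q(1), of "\<lambda>j. w (j + L)"] w by auto
      have Z: "finite (Z d)" "card (Z d) \<le> N" if "d \<in> D" for d
      proof -
        have "range (w(i := d)) \<subseteq> carrier U" using w that by (auto simp: D_def)
        then show "finite (Z d)" "card (Z d) \<le> N"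
          using less.prems(2) unfolding fin_fibres_def Z_def by blast+
      qed
      have sub: "{z \<in> carrier U. sat U (w(0 := z)) p'} \<subseteq> (\<Union>d\<in>D. Z d)"
      proof
        fix z assume "z \<in> {z \<in> carrier U. sat U (w(0 := z)) p'}"
        then obtain d where d: "d \<in> carrier U" "z \<in> carrier U" "sat U ((w(0 := z))(i := d)) p"
          "sat U ((w(0 := z))(i := d)) q'"
          unfolding p'_def by (auto simp del: fun_upd_apply)
        have "sat U (w(i := d)) q'"
          using d(4) by (rule sat_cong[THEN iffD1, rotated]) (use q'0 in \<open>auto split: if_splits\<close>)
        moreover have "(w(0 := z))(i := d) = (w(i := d))(0 := z)"
          using i(2) by (simp add: fun_upd_twist)
        ultimately show "z \<in> (\<Union>d\<in>D. Z d)"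
          using d by (auto simp: D_def Z_def simp del: fun_upd_apply)
      qed
      have finU: "finite (\<Union>d\<in>D. Z d)" using D Z by auto
      have "card (\<Union>d\<in>D. Z d) \<le> (\<Sum>d\<in>D. card (Z d))"
        using D(1) by (rule card_UN_le)
      also have "\<dots> \<le> (\<Sum>d\<in>D. N)" using Z by (intro sum_mono) auto
      also have "\<dots> \<le> N' * N" using D by simp
      finally show "finite {z \<in> carrier U. sat U (w(0 := z)) p'} \<and>
          card {z \<in> carrier U. sat U (w(0 := z)) p'} \<le> N' * N"
        using finite_subset[OF sub finU] card_mono[OF finU sub] by linarith
    qed
    have rng: "range e' \<subseteq> carrier U"
      using less.prems(3) q(2) by (auto simp: e'_def)
    have fp': "free_vars p' - {0} \<subseteq> (free_vars p - {0, i}) \<union> (\<lambda>j. j + L) ` (free_vars q - {0})"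
      using fq' by (auto simp: p'_def)
    have e'q: "e' (j + L) \<in> S" if "j \<in> free_vars q - {0}" for j
      using that q(3) by (auto simp: e'_def)
    have e'p: "e' j = e j" if "j \<in> free_vars p" for j
      using that L by (auto simp: e'_def)
    \<comment> \<open>Variable \<open>i\<close> has become bound and the parameters taken over from
      \<open>q\<close> lie in \<open>S\<close>, so the number of parameters outside \<open>S\<close>
      drops.\<close>
    have bad: "{j \<in> free_vars p' - {0}. e' j \<notin> S} \<subseteq> {j \<in> free_vars p - {0}. e j \<notin> S} - {i}"
      using fp' e'q e'p by fastforce
    have good: "e' j \<in> macl S" if j: "j \<in> free_vars p'" "j \<noteq> 0" for j
    proof -
      consider "j \<in> free_vars p" | k where "k \<in> free_vars q - {0}" "j = k + L"
        using fp' j by blast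
      then show ?thesis
      proof cases
        case 1
        then show ?thesis using less.prems(4)[OF _ j(2)] e'p by simp
      next
        case 2
        then obtain d where "e' j = f k" "f k \<in> S" "k \<noteq> 0" using q(3) by (auto simp: e'_def)
        moreover have "f k \<in> carrier U" using q(2) by auto
        ultimately show ?thesis
          using subset_macl[of "{f k}"] macl_mono[of "{f k}" S] by auto
      qed
    qed
    have sat: "sat U (e'(0 := x)) p'"
    proof -
      have "sat U ((e'(0 := x))(i := e i)) p"
        using less.prems(5) by (rule sat_cong[THEN iffD1, rotated]) (use i(2) in \<open>auto simp: e'p\<close>)
      moreover have "sat U ((e'(0 := x))(i := e i)) q'"
        unfolding satq' using q(4)
        by (rule sat_cong[THEN iffD1, rotated]) (use Li in \<open>auto simp: e'_def\<close>)
      moreover have "e i \<in> carrier U" using less.prems(3) by auto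
      ultimately show ?thesis unfolding p'_def by auto
    qed
    define B where "B = {j \<in> free_vars p - {0}. e j \<notin> S}"
    define B' where "B' = {j \<in> free_vars p' - {0}. e' j \<notin> S}"
    have "finite B" "i \<in> B" using finite_free_vars[of p] i by (auto simp: B_def)
    then have "card B' < card B"
      using card_mono[of "B - {i}" B'] bad psubset_card_mono[of B B'] by (auto simp: B_def B'_def)
    then show ?thesis
      using less.hyps[of p' e', OF _ less.prems(1) fin rng good sat] by (simp add: B_def B'_def)
  qed
qed

lemma macl_idem: "macl (macl S) \<subseteq> macl S"
proof
  fix x assume "x \<in> macl (macl S)"
  then show "x \<in> macl S"
    by (rule maclE) (rule macl_idem_witness)
qed

lemma macl_trans: "x \<in> macl S \<Longrightarrow> S \<subseteq> macl T \<Longrightarrow> x \<in> macl T"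
  using macl_mono[of S "macl T"] macl_idem[of T] by blast

section \<open>Field operations, shift and derivation on \<open>macl\<close>\<close>

lemma tm_val_macl:
  assumes t: "0 \<notin> tm_vars t" and e: "\<And>i. i \<in> tm_vars t \<Longrightarrow> e i \<in> macl S"
  shows "tm_val U e t \<in> macl S"
proof (rule macl_idem_witness)
  \<comment> \<open>Nothing is known about \<open>e\<close> off the variables of \<open>t\<close>,
    so it is reset there to stay in the carrier.\<close>
  define e' where "e' = (\<lambda>i. if i \<in> tm_vars t then e i else \<zero>)"
  show "tm_val U e t \<in> carrier U"
    using e macl_carrier by (intro tm_val_closed) auto
  show "fin_fibres (Eq (Var 0) t) 1" using t by (rule fin_fibres_Eq)
  show "range e' \<subseteq> carrier U" using e macl_carrier by (auto simp: e'_def)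
  show "e' i \<in> macl S" if "i \<in> free_vars (Eq (Var 0) t)" "i \<noteq> 0" for i
    using that e by (auto simp: e'_def)
  have "tm_val U (e'(0 := tm_val U e t)) t = tm_val U e t"
    using t by (intro tm_val_cong) (auto simp: e'_def)
  then show "sat U (e'(0 := tm_val U e t)) (Eq (Var 0) t)" by simp
qed

text \<open>Covers operations without a symbol in the language: the inverse of a field element and
  the inverse of the shift are unique solutions of an equation with parameter
  \<open>x\<close>.\<close>

lemma macl_solution:
  assumes "x \<in> macl S" "y \<in> carrier U" "fin_fibres p N" "free_vars p \<subseteq> {0, 1}"
    "sat U ((\<lambda>_. x)(0 := y)) p"
  shows "y \<in> macl S"
  using assms macl_carrier by (intro macl_idem_witness[of y p N "\<lambda>_. x"]) auto

lemma macl_closed: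
  shows "\<zero> \<in> macl S" "\<one> \<in> macl S"
    and "x \<in> macl S \<Longrightarrow> y \<in> macl S \<Longrightarrow> x \<oplus> y \<in> macl S"
    and "x \<in> macl S \<Longrightarrow> y \<in> macl S \<Longrightarrow> x \<otimes> y \<in> macl S"
    and "x \<in> macl S \<Longrightarrow> \<ominus> x \<in> macl S"
    and "x \<in> macl S \<Longrightarrow> shift U x \<in> macl S"
    and "x \<in> macl S \<Longrightarrow> der U x \<in> macl S"
proof -
  show "\<zero> \<in> macl S" "\<one> \<in> macl S"
    using tm_val_macl[of Zero _ S] tm_val_macl[of One _ S] by auto
  show "x \<oplus> y \<in> macl S" "x \<otimes> y \<in> macl S" if "x \<in> macl S" "y \<in> macl S"
    using that tm_val_macl[of "Add (Var 1) (Var 2)" "\<lambda>i. if i = 1 then x else y" S]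
      tm_val_macl[of "Mult (Var 1) (Var 2)" "\<lambda>i. if i = 1 then x else y" S] by simp_all
  assume x: "x \<in> macl S"
  then show "\<ominus> x \<in> macl S"
    using tm_val_macl[of "Opp (Var 1)" "\<lambda>_. x" S] opp_eq[of x] subsetD[OF macl_carrier x] by simp
  show "shift U x \<in> macl S" "der U x \<in> macl S"
    using x tm_val_macl[of "Shift (Var 1)" "\<lambda>_. x" S] tm_val_macl[of "Der (Var 1)" "\<lambda>_. x" S]
    by simp_all
qed

lemma macl_subfield: "subfield (macl S) U"
proof (rule subfieldI')
  show "subring (macl S) U"
    by (rule subringI) (auto simp: macl_closed intro: subsetD[OF macl_carrier])
  fix x assume x: "x \<in> macl S - {\<zero>}"
  then have u: "x \<in> Units U" using field_Units macl_carrier by auto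
  have fin: "fin_fibres (Eq (Mult (Var 0) (Var 1)) One) 1"
  proof (rule fin_fibres_unique)
    fix w :: "nat \<Rightarrow> 'a" and z z'
    assume "range w \<subseteq> carrier U" "z \<in> carrier U" "z' \<in> carrier U"
      "sat U (w(0 := z)) (Eq (Mult (Var 0) (Var 1)) One)"
      "sat U (w(0 := z')) (Eq (Mult (Var 0) (Var 1)) One)"
    then have w: "w 1 \<in> carrier U" "z \<otimes> w 1 = \<one>" "z' \<otimes> w 1 = \<one>"
      by auto
    then have "w 1 \<otimes> z' = \<one>"
      using m_comm[of z' "w 1"] \<open>z' \<in> carrier U\<close> by simp
    with w show "z = z'"
      using \<open>z \<in> carrier U\<close> \<open>z' \<in> carrier U\<close> inv_unique by blast
  qed
  show "inv x \<in> macl S"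
    by (rule macl_solution[OF _ _ fin, of x]) (use x u in auto)
qed

lemma shift_macl: "shift U ` macl S = macl S"
proof
  show "macl S \<subseteq> shift U ` macl S"
  proof
    fix x assume x: "x \<in> macl S"
    have inj: "inj_on (shift U) (carrier U)" and img: "shift U ` carrier U = carrier U"
      using shift_bij by (simp_all add: bij_betw_def)
    obtain y where y: "y \<in> carrier U" "shift U y = x"
      using subsetD[OF macl_carrier x] img by (metis imageE)
    have fin: "fin_fibres (Eq (Shift (Var 0)) (Var 1)) 1"
      by (intro fin_fibres_unique) (auto intro: inj_onD[OF inj])
    have "y \<in> macl S"
      by (rule macl_solution[OF x y(1) fin]) (use y in auto)
    then show "x \<in> shift U ` macl S" using y by blast
  qed
qed (auto simp: macl_closed)

lemma dd_generated_macl: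
  assumes "S \<subseteq> carrier U"
  shows "dd_generated U S \<subseteq> macl S"
  unfolding dd_generated_def
  using subset_macl[OF assms] macl_subfield[of S] shift_macl[of S] macl_closed(7)[of _ S]
  by (intro Inter_lower) auto

section \<open>Roots of polynomials and comparison with \<open>acl\<close>\<close>

primrec pow_tm :: "nat \<Rightarrow> tm" where
  "pow_tm 0 = One"
| "pow_tm (Suc n) = Mult (pow_tm n) (Var 0)"

text \<open>The general polynomial in variable \<open>0\<close> of degree less than \<open>n\<close>; variable \<open>Suc d\<close> is the
  coefficient of degree \<open>d\<close>.\<close>

primrec poly_tm :: "nat \<Rightarrow> tm" where
  "poly_tm 0 = Zero"
| "poly_tm (Suc n) = Add (Mult (Var (Suc n)) (pow_tm n)) (poly_tm n)"

lemma tm_val_pow_tm: "tm_val U e (pow_tm n) = e 0 [^] n"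
  by (induction n) auto

lemma tm_val_poly_tm:
  "tm_val U e (poly_tm n) = eval (map (\<lambda>d. e (Suc d)) (rev [0..<n])) (e 0)"
  by (induction n) (auto simp: tm_val_pow_tm)

text \<open>Variable \<open>n\<close> is the leading coefficient. Its nonvanishing belongs to the
  formula, since the zero polynomial would destroy the bound on the number of roots.\<close>

definition root_fm :: "nat \<Rightarrow> fm" where
  "root_fm n = Conj (Neg (Eq (Var n) Zero)) (Eq (poly_tm n) Zero)"

lemma fin_fibres_root_fm:
  assumes "n > 0"
  shows "fin_fibres (root_fm n) n"
  unfolding fin_fibres_def
proof (intro allI impI)
  fix w :: "nat \<Rightarrow> 'a" assume w: "range w \<subseteq> carrier U"
  define q where "q = map (\<lambda>d. w (Suc d)) (rev [0..<n])"
  obtain m where m: "n = Suc m" using assms by (cases n) auto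
  show "finite {z \<in> carrier U. sat U (w(0 := z)) (root_fm n)} \<and>
      card {z \<in> carrier U. sat U (w(0 := z)) (root_fm n)} \<le> n"
  proof (cases "w n = \<zero>")
    case True
    then show ?thesis using assms by (simp add: root_fm_def)
  next
    case False
    have "polynomial (carrier U) q"
      using False w by (auto simp: polynomial_def q_def m)
    then have q: "q \<in> carrier (poly_ring U)" by (simp add: univ_poly_carrier)
    have sub: "{z \<in> carrier U. sat U (w(0 := z)) (root_fm n)} \<subseteq> set_mset (roots q)"
    proof
      fix z assume "z \<in> {z \<in> carrier U. sat U (w(0 := z)) (root_fm n)}"
      then have "is_root q z"
        by (auto simp: root_fm_def tm_val_poly_tm tm_val_pow_tm is_root_def q_def m)
      then show "z \<in># roots q" using roots_mem_iff_is_root[OF q] by simp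
    qed
    have "card (set_mset (roots q)) \<le> n"
      using size_roots_le_degree[OF q] size_mset_mono[OF mset_set_set_mset_msubset, of "roots q"] by (simp add: q_def)
    then show ?thesis
      using finite_subset[OF sub finite_set_mset] card_mono[OF finite_set_mset sub] by linarith
  qed
qed

text \<open>Lets non-membership in \<open>macl\<close> be used against independence, which is stated
  with \<open>acl\<close>. An annihilating polynomial has coefficients in \<open>macl S\<close>, and
  idempotence applied to \<open>root_fm\<close> then places its root there.\<close>

lemma acl_macl:
  assumes "S \<subseteq> carrier U"
  shows "acl U S \<subseteq> macl S"
proof
  fix x assume "x \<in> acl U S"
  then have x: "x \<in> carrier U" "(algebraic over (dd_generated U S)) x"
    by (auto simp: acl_def over_def)
  have "(algebraic over (macl S)) x"
    using x(2) dd_generated_macl[OF assms] algebraic_mono by blast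
  then obtain p where p: "polynomial (macl S) p" "p \<noteq> []" "eval p x = \<zero>"
    using algebraicE[OF subfieldE(1)[OF macl_subfield] x(1)] by (metis univ_poly_carrier)
  define n where "n = length p"
  \<comment> \<open>The list \<open>p\<close> starts with the leading coefficient, so variable
    \<open>i\<close>, the coefficient of degree \<open>i - 1\<close>, is read at position
    \<open>n - i\<close>.\<close>
  define e where "e = (\<lambda>i. if 0 < i \<and> i \<le> n then p ! (n - i) else \<zero>)"
  have pK: "set p \<subseteq> macl S" "lead_coeff p \<noteq> \<zero>" using p by (auto simp: polynomial_def)
  have eK: "e i \<in> macl S" for i
  proof (cases "0 < i \<and> i \<le> n")
    case True
    then have "p ! (n - i) \<in> set p" by (intro nth_mem) (auto simp: n_def)
    then show ?thesis using True pK by (auto simp: e_def)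
  qed (auto simp: e_def macl_closed)
  have n: "n > 0" using p by (simp add: n_def)
  have p_eq: "map (\<lambda>d. e (Suc d)) (rev [0..<n]) = p"
    by (rule nth_equalityI) (auto simp: n_def e_def rev_nth)
  have "e n \<noteq> \<zero>" using pK p n by (simp add: e_def hd_conv_nth)
  then have "sat U (e(0 := x)) (root_fm n)"
    using n p p_eq by (simp add: root_fm_def tm_val_poly_tm)
  then show "x \<in> macl S"
    using eK macl_carrier
    by (intro macl_idem_witness[OF x(1) fin_fibres_root_fm[OF n]]) auto
qed

section \<open>Field structure of \<open>acl\<close>\<close>

lemma dd_generated_subfield: "subfield (dd_generated U S) U"
  if S: "S \<subseteq> carrier U"
proof -
  let ?F = "{K. subfield K U \<and> S \<subseteq> K \<and> shift U ` K = K \<and> der U ` K \<subseteq> K}"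
  \<comment> \<open>This makes the family nonempty, so its intersection stays inside the
    carrier.\<close>
  have "carrier U \<in> ?F"
    using S carrier_is_subfield shift_bij der_closed by (auto simp: bij_betw_def)
  then have "subring (\<Inter>?F) U"
    by (intro subring_Inter) (auto dest: subfieldE)
  then show ?thesis
    unfolding dd_generated_def
    by (rule subfieldI') (use subfield_m_inv(1) in auto)
qed

lemma acl_subfield: "S \<subseteq> carrier U \<Longrightarrow> subfield (acl U S) U"
  using subfield_of_algebraics[OF dd_generated_subfield[of S]] by (simp add: acl_def over_def)

lemma subset_acl:
  assumes "S \<subseteq> carrier U"
  shows "S \<subseteq> acl U S"
proof
  fix x assume x: "x \<in> S"
  then have "x \<in> dd_generated U S" by (auto simp: dd_generated_def)
  then show "x \<in> acl U S"
    using x assms algebraic_self[OF subfieldE(1)[OF dd_generated_subfield[OF assms]]]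
    by (auto simp: acl_def over_def)
qed

lemma acl_carrier: "acl U S \<subseteq> carrier U"
  by (auto simp: acl_def)


section \<open>Definable predicates and saturation\<close>

text \<open>Variables below \<open>k\<close> are arguments, the others are parameters from \<open>S\<close>.\<close>

definition dfn :: "nat \<Rightarrow> 'a set \<Rightarrow> ((nat \<Rightarrow> 'a) \<Rightarrow> bool) \<Rightarrow> bool" where
  "dfn k S R \<longleftrightarrow> (\<exists>p e. range e \<subseteq> carrier U \<and> (\<forall>i\<in>free_vars p. k \<le> i \<longrightarrow> e i \<in> S) \<and>
     (\<forall>w. (\<forall>i<k. w i \<in> carrier U) \<longrightarrow> R w = sat U (\<lambda>i. if i < k then w i else e i) p))"

lemma dfnE:
  assumes "dfn k S R"
  obtains p e where "range e \<subseteq> carrier U" "\<forall>i\<in>free_vars p. k \<le> i \<longrightarrow> e i \<in> S"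
    "\<forall>w. (\<forall>i<k. w i \<in> carrier U) \<longrightarrow> R w = sat U (\<lambda>i. if i < k then w i else e i) p"
  using assms unfolding dfn_def by blast

text \<open>Renumbering of arguments and parameters is absorbed into the choice of the terms
  \<open>t\<close>, so that no formula has to be rewritten by hand.\<close>

lemma dfn_sat:
  assumes "range f \<subseteq> carrier U"
    and "\<And>i j. i \<in> free_vars p \<Longrightarrow> j \<in> tm_vars (t i) \<Longrightarrow> k \<le> j \<Longrightarrow> f j \<in> S"
    and "\<And>w. (\<And>i. i < k \<Longrightarrow> w i \<in> carrier U) \<Longrightarrow>
      R w = sat U (\<lambda>i. tm_val U (\<lambda>j. if j < k then w j else f j) (t i)) p"
  shows "dfn k S R"
  unfolding dfn_def
proof (intro exI[of _ "fm_subst p t"] exI[of _ f] conjI ballI impI allI)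
  show "f i \<in> S" if "i \<in> free_vars (fm_subst p t)" "k \<le> i" for i
    using that free_vars_subst[of p t] assms(2) by blast
qed (use assms in \<open>auto simp: sat_subst\<close>)

lemma dfn_neg:
  assumes "dfn k S R"
  shows "dfn k S (\<lambda>w. \<not> R w)"
proof -
  obtain p e where p: "range e \<subseteq> carrier U" "\<forall>i\<in>free_vars p. k \<le> i \<longrightarrow> e i \<in> S"
    "\<forall>w. (\<forall>i<k. w i \<in> carrier U) \<longrightarrow> R w = sat U (\<lambda>i. if i < k then w i else e i) p"
    by (rule dfnE[OF assms])
  then show ?thesis
    unfolding dfn_def by (intro exI[of _ "Neg p"] exI[of _ e]) auto
qed

lemma dfn_conj:
  assumes "dfn k S R" "dfn k S R'"
  shows "dfn k S (\<lambda>w. R w \<and> R' w)"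
proof -
  obtain p e where p: "range e \<subseteq> carrier U" "\<forall>i\<in>free_vars p. k \<le> i \<longrightarrow> e i \<in> S"
    "\<forall>w. (\<forall>i<k. w i \<in> carrier U) \<longrightarrow> R w = sat U (\<lambda>i. if i < k then w i else e i) p"
    by (rule dfnE[OF assms(1)])
  note p = p(1) p(2,3)[rule_format]
  obtain p' e' where p': "range e' \<subseteq> carrier U" "\<forall>i\<in>free_vars p'. k \<le> i \<longrightarrow> e' i \<in> S"
    "\<forall>w. (\<forall>i<k. w i \<in> carrier U) \<longrightarrow> R' w = sat U (\<lambda>i. if i < k then w i else e' i) p'"
    by (rule dfnE[OF assms(2)])
  note p' = p'(1) p'(2,3)[rule_format]
  \<comment> \<open>The parameters of \<open>p\<close> go to even and those of \<open>p'\<close> to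
    odd distance from \<open>k\<close>, so that one environment \<open>f\<close> carries
    both.\<close>
  define s where "s = (\<lambda>i. Var (if i < k then i else k + 2 * (i - k)))"
  define s' where "s' = (\<lambda>i. Var (if i < k then i else k + 2 * (i - k) + 1))"
  define f where "f = (\<lambda>i. if even (i - k) then e (k + (i - k) div 2) else e' (k + (i - k) div 2))"
  let ?q = "Conj (fm_subst p s) (fm_subst p' s')"
  have f: "range f \<subseteq> carrier U" using p(1) p'(1) by (auto simp: f_def)
  have fs: "f i \<in> S" if i: "i \<in> free_vars ?q" "k \<le> i" for i
  proof -
    consider j where "j \<in> free_vars p" "i \<in> tm_vars (s j)" | j where "j \<in> free_vars p'" "i \<in> tm_vars (s' j)"
      using i free_vars_subst[of p s] free_vars_subst[of p' s'] by auto
    then show ?thesis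
    proof cases
      case 1
      then have "k \<le> j" "i = k + 2 * (j - k)" using i(2) by (auto simp: s_def split: if_splits)
      then show ?thesis using p(2)[OF 1(1)] by (simp add: f_def)
    next
      case 2
      then have "k \<le> j" "i = k + 2 * (j - k) + 1" using i(2) by (auto simp: s'_def split: if_splits)
      then show ?thesis using p'(2)[OF 2(1)] by (simp add: f_def)
    qed
  qed
  have eq: "(\<lambda>i. tm_val U (\<lambda>i. if i < k then w i else f i) (s i)) = (\<lambda>i. if i < k then w i else e i)"
    "(\<lambda>i. tm_val U (\<lambda>i. if i < k then w i else f i) (s' i)) = (\<lambda>i. if i < k then w i else e' i)" for w
    by (auto simp: s_def s'_def f_def fun_eq_iff)
  show ?thesis
    unfolding dfn_def
  proof (intro exI[of _ ?q] exI[of _ f] conjI ballI impI allI f)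
    show "(R w \<and> R' w) = sat U (\<lambda>i. if i < k then w i else f i) ?q"
      if "\<forall>i<k. w i \<in> carrier U" for w
      using that p(3)[of w] p'(3)[of w] by (simp add: sat_subst eq)
  qed (use fs in auto)
qed

lemma dfn_ball:
  assumes "finite F" "\<And>R. R \<in> F \<Longrightarrow> dfn k S (Q R)"
  shows "dfn k S (\<lambda>w. \<forall>R\<in>F. Q R w)"
  using assms
proof (induction F rule: finite_induct)
  case empty
  show ?case by (rule dfn_sat[of "\<lambda>_. \<zero>" "Eq Zero Zero" "\<lambda>_. Zero"]) auto
next
  case (insert R F)
  then show ?case using dfn_conj[of k S "Q R" "\<lambda>w. \<forall>R\<in>F. Q R w"] by simp
qed

lemma dfn_ex:
  assumes "dfn (Suc k) S R"
  shows "dfn k S (\<lambda>w. \<exists>y\<in>carrier U. R (w(k := y)))"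
proof -
  obtain p e where p: "range e \<subseteq> carrier U" "\<forall>i\<in>free_vars p. Suc k \<le> i \<longrightarrow> e i \<in> S"
    "\<forall>w. (\<forall>i<Suc k. w i \<in> carrier U) \<longrightarrow> R w = sat U (\<lambda>i. if i < Suc k then w i else e i) p"
    by (rule dfnE[OF assms])
  note p = p(1) p(2,3)[rule_format]
  have eq: "(\<lambda>i. if i < Suc k then (w(k := y)) i else e i) = (\<lambda>i. if i < k then w i else e i)(k := y)" for w y
    by (auto simp: fun_eq_iff)
  show ?thesis
    unfolding dfn_def
  proof (intro exI[of _ "Ex k p"] exI[of _ e] conjI ballI impI allI p(1))
    show "e i \<in> S" if "i \<in> free_vars (Ex k p)" "k \<le> i" for i
      using that p(2)[of i] by auto
    show "(\<exists>y\<in>carrier U. R (w(k := y))) = sat U (\<lambda>i. if i < k then w i else e i) (Ex k p)"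
      if "\<forall>i<k. w i \<in> carrier U" for w
    proof -
      have "R (w(k := y)) = sat U ((\<lambda>i. if i < k then w i else e i)(k := y)) p" if "y \<in> carrier U" for y
        unfolding eq[symmetric] using \<open>\<forall>i<k. w i \<in> carrier U\<close> that by (intro p(3)) (auto simp: less_Suc_eq)
      then show ?thesis by (simp del: fun_upd_apply cong: bex_cong)
    qed
  qed
qed

text \<open>Restates saturation for predicates instead of formulas with parameters, so that types
  can be described by their meaning.\<close>

lemma saturated_dfn:
  assumes sat: "saturated U" and S: "small U S"
    and def: "\<And>P. P \<in> Q \<Longrightarrow> dfn 1 S (\<lambda>w. P (w 0))"
    and fin: "\<And>F. finite F \<Longrightarrow> F \<subseteq> Q \<Longrightarrow> \<exists>x\<in>carrier U. \<forall>P\<in>F. P x"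
  shows "\<exists>x\<in>carrier U. \<forall>P\<in>Q. P x"
proof -
  \<comment> \<open>Every formula over \<open>S\<close> that represents some member of
    \<open>Q\<close>; a finite part of \<open>T\<close> then follows from finitely many members of
    \<open>Q\<close>.\<close>
  define T where "T = {(p, e). (\<forall>i\<in>free_vars p - {0}. e i \<in> S) \<and>
    (\<exists>P\<in>Q. \<forall>x\<in>carrier U. P x = sat U (e(0 := x)) p)}"
  have rep: "\<exists>p e. (p, e) \<in> T \<and> (\<forall>x\<in>carrier U. P x = sat U (e(0 := x)) p)" if P: "P \<in> Q" for P
  proof -
    obtain p e where p: "range e \<subseteq> carrier U" "\<forall>i\<in>free_vars p. 1 \<le> i \<longrightarrow> e i \<in> S"
      "\<forall>w. (\<forall>i<1. w i \<in> carrier U) \<longrightarrow> P (w 0) = sat U (\<lambda>i. if i < 1 then w i else e i) p"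
      by (rule dfnE[OF def[OF P]])
    note p = p(1) p(2,3)[rule_format]
    have eq: "e(0 := x) = (\<lambda>i. if i < 1 then x else e i)" for x by (auto simp: fun_eq_iff)
    have "\<forall>x\<in>carrier U. P x = sat U (e(0 := x)) p"
      unfolding eq using p(3)[of "\<lambda>_. x" for x] by auto
    then show ?thesis
      using p(2) P unfolding T_def by (intro exI[of _ p] exI[of _ e]) auto
  qed
  have ex: "\<exists>x. realizes U x Q'" if Q': "finite Q'" "Q' \<subseteq> T" for Q'
  proof -
    have "\<forall>pe\<in>Q'. \<exists>P. P \<in> Q \<and> (\<forall>x\<in>carrier U. P x = sat U ((snd pe)(0 := x)) (fst pe))"
    proof
      fix pe assume "pe \<in> Q'"
      then have "pe \<in> T" using Q'(2) by blast
      then show "\<exists>P. P \<in> Q \<and> (\<forall>x\<in>carrier U. P x = sat U ((snd pe)(0 := x)) (fst pe))"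
        unfolding T_def by (cases pe) auto
    qed
    from bchoice[OF this] obtain g where
      g: "\<forall>pe\<in>Q'. g pe \<in> Q \<and> (\<forall>x\<in>carrier U. g pe x = sat U ((snd pe)(0 := x)) (fst pe))" ..
    have "finite (g ` Q')" "g ` Q' \<subseteq> Q" using Q'(1) g by auto
    from fin[OF this] obtain x where x: "x \<in> carrier U" "\<forall>P\<in>g ` Q'. P x" by blast
    have "sat U ((snd pe)(0 := x)) (fst pe)" if "pe \<in> Q'" for pe
      using bspec[OF g that] bspec[OF x(2) imageI[OF that]] x(1) by simp
    then show ?thesis using x(1) unfolding realizes_def by auto
  qed
  have "\<forall>(p, e)\<in>T. \<forall>i\<in>free_vars p - {0}. e i \<in> S" by (auto simp: T_def)
  with S ex have "small U S \<and> (\<forall>(p, e)\<in>T. \<forall>i\<in>free_vars p - {0}. e i \<in> S) \<and>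
      (\<forall>Q'. finite Q' \<and> Q' \<subseteq> T \<longrightarrow> (\<exists>x. realizes U x Q'))"
    by simp
  then have "\<exists>x. realizes U x T"
    by (rule sat[unfolded saturated_def, THEN spec, THEN spec, THEN mp])
  then obtain x where x: "realizes U x T" ..
  show ?thesis
  proof (intro bexI[of _ x] ballI)
    show xc: "x \<in> carrier U" using x by (simp add: realizes_def)
    fix P assume "P \<in> Q"
    then obtain p e where "(p, e) \<in> T" "P x = sat U (e(0 := x)) p" using rep xc by blast
    then show "P x" using x by (auto simp: realizes_def)
  qed
qed

lemma small_insert:
  assumes "small U S" "x \<in> carrier U"
  shows "small U (insert x S)"
proof (cases "finite S")
  case True
  then show ?thesis
    using assms infinite_carrier finite_lesspoll_infinite[of "carrier U" "insert x S"]
    by (simp add: small_def)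
next
  case False
  then show ?thesis
    using assms infinite_insert_lepoll[of S x] lesspoll_trans1 unfolding small_def by blast
qed

lemma small_Un_finite:
  assumes "finite F" "small U S" "F \<subseteq> carrier U"
  shows "small U (S \<union> F)"
  using assms by (induction F rule: finite_induct) (auto simp: small_insert)

text \<open>Saturation is assumed for types in one variable. First \<open>x\<close> is found such
  that every finite part of \<open>Q\<close> remains solvable in \<open>y\<close>, a condition
  definable by quantifying over \<open>y\<close>; then \<open>y\<close> is found with
  \<open>x\<close> as a further parameter.\<close>

lemma saturated_dfn_pair:
  assumes sat: "saturated U" and S: "small U S"
    and def: "\<And>R. R \<in> Q \<Longrightarrow> dfn 2 S (\<lambda>w. R (w 0) (w 1))"
    and fin: "\<And>F. finite F \<Longrightarrow> F \<subseteq> Q \<Longrightarrow> \<exists>x\<in>carrier U. \<exists>y\<in>carrier U. \<forall>R\<in>F. R x y"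
  shows "\<exists>x\<in>carrier U. \<exists>y\<in>carrier U. \<forall>R\<in>Q. R x y"
proof -
  define Q1 where "Q1 = {(\<lambda>x. \<exists>y\<in>carrier U. \<forall>R\<in>F. R x y) | F. finite F \<and> F \<subseteq> Q}"
  have "\<exists>x\<in>carrier U. \<forall>P\<in>Q1. P x"
  proof (rule saturated_dfn[OF sat S])
    fix P assume "P \<in> Q1"
    then obtain F where F: "finite F" "F \<subseteq> Q" "P = (\<lambda>x. \<exists>y\<in>carrier U. \<forall>R\<in>F. R x y)"
      unfolding Q1_def by blast
    have "dfn (Suc 1) S (\<lambda>w. \<forall>R\<in>F. R (w 0) (w 1))"
      using F def by (intro dfn_ball) (auto simp: numeral_2_eq_2)
    from dfn_ex[OF this] show "dfn 1 S (\<lambda>w. P (w 0))" by (simp add: F(3))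
  next
    fix \<F> assume "finite \<F>" "\<F> \<subseteq> Q1"
    have "\<forall>P\<in>\<F>. \<exists>F. finite F \<and> F \<subseteq> Q \<and> P = (\<lambda>x. \<exists>y\<in>carrier U. \<forall>R\<in>F. R x y)"
      using \<open>\<F> \<subseteq> Q1\<close> unfolding Q1_def by blast
    from bchoice[OF this] obtain h where
      h: "\<forall>P\<in>\<F>. finite (h P) \<and> h P \<subseteq> Q \<and> P = (\<lambda>x. \<exists>y\<in>carrier U. \<forall>R\<in>h P. R x y)" ..
    have "finite (\<Union>P\<in>\<F>. h P)" "(\<Union>P\<in>\<F>. h P) \<subseteq> Q" using h \<open>finite \<F>\<close> by auto
    from fin[OF this] obtain x y where
      xy: "x \<in> carrier U" "y \<in> carrier U" "\<forall>R\<in>(\<Union>P\<in>\<F>. h P). R x y" by blast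
    have "P x" if P: "P \<in> \<F>" for P
    proof -
      have "\<exists>y\<in>carrier U. \<forall>R\<in>h P. R x y" using xy P by blast
      moreover have "P = (\<lambda>x. \<exists>y\<in>carrier U. \<forall>R\<in>h P. R x y)" using h P by blast
      ultimately show ?thesis by (simp add: fun_eq_iff)
    qed
    then show "\<exists>x\<in>carrier U. \<forall>P\<in>\<F>. P x" using xy(1) by blast
  qed
  then obtain x where x1: "x \<in> carrier U" "\<forall>P\<in>Q1. P x" ..
  have x: "\<exists>y\<in>carrier U. \<forall>R\<in>F. R x y" if "finite F" "F \<subseteq> Q" for F
  proof -
    have "(\<lambda>x. \<exists>y\<in>carrier U. \<forall>R\<in>F. R x y) \<in> Q1" using that unfolding Q1_def by blast
    from bspec[OF x1(2) this] show ?thesis .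
  qed
  have "\<exists>y\<in>carrier U. \<forall>P\<in>(\<lambda>R. R x) ` Q. P y"
  proof (rule saturated_dfn[OF sat small_insert[OF S x1(1)]])
    fix P assume "P \<in> (\<lambda>R. R x) ` Q"
    then obtain R where R: "R \<in> Q" "P = R x" by blast
    obtain p e where p: "range e \<subseteq> carrier U" "\<forall>i\<in>free_vars p. 2 \<le> i \<longrightarrow> e i \<in> S"
      "\<forall>w. (\<forall>i<2. w i \<in> carrier U) \<longrightarrow> R (w 0) (w 1) = sat U (\<lambda>i. if i < 2 then w i else e i) p"
      by (rule dfnE[OF def[OF R(1)]])
    note p = p(1) p(2,3)[rule_format]
    show "dfn 1 (insert x S) (\<lambda>w. P (w 0))"
    \<comment> \<open>The variables \<open>0\<close> and \<open>1\<close> are exchanged: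
      \<open>y\<close> becomes the argument, and \<open>x\<close> a parameter at place
      \<open>1\<close>.\<close>
    proof (rule dfn_sat[of "e(1 := x)" p "\<lambda>i. if i = 0 then Var 1 else if i = 1 then Var 0 else Var i"])
      show "range (e(1 := x)) \<subseteq> carrier U" using p(1) x1(1) by auto
      show "(e(1 := x)) j \<in> insert x S"
        if "i \<in> free_vars p" "1 \<le> j"
          "j \<in> tm_vars (if i = 0 then Var 1 else if i = 1 then Var 0 else Var i)" for i j
        using that p(2) by (auto split: if_splits)
      fix w :: "nat \<Rightarrow> 'a" assume w: "\<And>i. i < 1 \<Longrightarrow> w i \<in> carrier U"
      define v where "v = (\<lambda>i::nat. if i = 0 then x else w 0)"
      have "R (v 0) (v 1) = sat U (\<lambda>i. if i < 2 then v i else e i) p"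
        using w x1(1) by (intro p(3)) (auto simp: v_def)
      also have "\<dots> = sat U (\<lambda>i. tm_val U (\<lambda>j. if j < 1 then w j else (e(1 := x)) j)
          (if i = 0 then Var 1 else if i = 1 then Var 0 else Var i)) p"
        by (intro sat_cong) (auto simp: v_def)
      finally show "P (w 0) = sat U (\<lambda>i. tm_val U (\<lambda>j. if j < 1 then w j else (e(1 := x)) j)
          (if i = 0 then Var 1 else if i = 1 then Var 0 else Var i)) p"
        by (simp add: R(2) v_def)
    qed
  next
    fix F assume F: "finite F" "F \<subseteq> (\<lambda>R. R x) ` Q"
    then obtain F' where "finite F'" "F' \<subseteq> Q" "F = (\<lambda>R. R x) ` F'"
      by (meson finite_subset_image)
    then show "\<exists>y\<in>carrier U. \<forall>P\<in>F. P y" using x[of F'] by auto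
  qed
  then show ?thesis using x1(1) by auto
qed


end


section \<open>Definable subgroups\<close>

text \<open>Fewer than \<open>R\<^sup>2\<close> points of the grid \<open>{..<R}\<^sup>2\<close> are bad for large \<open>R\<close>, as the grid meets only
  \<open>(m l + 1) R\<close> lines of each slope.\<close>

lemma ex_grid_point:
  fixes B :: "'l \<Rightarrow> nat \<Rightarrow> nat \<Rightarrow> bool" and m N :: "'l \<Rightarrow> nat"
  assumes L: "finite L"
    and B: "\<And>l t. l \<in> L \<Longrightarrow> finite {j. B l j t} \<and> card {j. B l j t} \<le> N l"
  shows "\<exists>j j'. \<forall>l\<in>L. \<not> B l j (j' + m l * j)"
proof (rule ccontr)
  assume neg: "\<nexists>j j'. \<forall>l\<in>L. \<not> B l j (j' + m l * j)"
  \<comment> \<open>The bad points will number at most \<open>K * R\<close>, which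
    \<open>R = K + 1\<close> makes smaller than \<open>R * R\<close>.\<close>
  define K where "K = (\<Sum>l\<in>L. (m l + 1) * N l)"
  define R where "R = K + 1"
  define D where "D l = {(j, j'). j < R \<and> j' < R \<and> B l j (j' + m l * j)}" for l
  have D: "finite (D l)" for l
    by (rule finite_subset[of _ "{..<R} \<times> {..<R}"]) (auto simp: D_def)
  have card_D: "card (D l) \<le> (m l + 1) * N l * R" if l: "l \<in> L" for l
  proof -
    \<comment> \<open>A grid point is determined by its line \<open>t = j' + m l * j\<close> and its
      first coordinate; on each line at most \<open>N l\<close> values of \<open>j\<close> are
      bad.\<close>
    let ?f = "\<lambda>(j, j'). (j' + m l * j, j)"
    let ?S = "SIGMA t:{..<(m l + 1) * R}. {j. B l j t}"
    have "j' + m l * j < (m l + 1) * R" if "j < R" "j' < R" for j j'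
    proof -
      have "m l * j \<le> m l * R" using that by simp
      moreover have "(m l + 1) * R = m l * R + R" by simp
      ultimately show ?thesis using that by linarith
    qed
    then have "?f ` D l \<subseteq> ?S" by (auto simp: D_def)
    moreover have "inj_on ?f (D l)" by (auto simp: inj_on_def)
    moreover have "finite ?S" using B[OF l] by auto
    ultimately have "card (D l) \<le> card ?S" by (intro card_inj_on_le)
    also have "\<dots> = (\<Sum>t<(m l + 1) * R. card {j. B l j t})"
      using B[OF l] by (intro card_SigmaI) auto
    also have "\<dots> \<le> (\<Sum>t<(m l + 1) * R. N l)" using B[OF l] by (intro sum_mono) auto
    finally show ?thesis by (simp add: algebra_simps)
  qed
  have "{..<R} \<times> {..<R} \<subseteq> (\<Union>l\<in>L. D l)" using neg by (fastforce simp: D_def)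
  then have "card ({..<R} \<times> {..<R}) \<le> card (\<Union>l\<in>L. D l)"
    using L D by (intro card_mono) auto
  also have "\<dots> \<le> (\<Sum>l\<in>L. card (D l))" using L by (rule card_UN_le)
  also have "\<dots> \<le> (\<Sum>l\<in>L. (m l + 1) * N l * R)" using card_D by (rule sum_mono)
  also have "\<dots> = K * R" by (simp add: K_def sum_distrib_right)
  finally have "R * R \<le> K * R" by simp
  then show False by (simp add: R_def)
qed

context dd_fld
begin

section \<open>Generic pairs in a definable subgroup\<close>

primrec nat_mult_tm :: "nat \<Rightarrow> tm \<Rightarrow> tm" where
  "nat_mult_tm 0 t = Zero"
| "nat_mult_tm (Suc m) t = Add (nat_mult_tm m t) t"

lemma tm_val_nat_mult: "tm_val U e (nat_mult_tm m t) = [m] \<cdot> tm_val U e t"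
  by (induction m) auto

lemma tm_vars_nat_mult: "tm_vars (nat_mult_tm m t) \<subseteq> tm_vars t"
  by (induction m) auto

text \<open>A parameter from \<open>insert (y \<oplus> [m] \<cdot> x) S\<close> either is the
  varying element or lies in \<open>S\<close>. The set \<open>I\<close> lists the variables of the
  first kind, which makes the condition on \<open>x\<close> and \<open>y\<close> definable over
  \<open>S\<close>.\<close>

definition fibre_rel :: "nat \<Rightarrow> nat set \<Rightarrow> (nat \<Rightarrow> 'a) \<Rightarrow> fm \<Rightarrow> 'a \<Rightarrow> 'a \<Rightarrow> bool" where
  "fibre_rel m I e p x y \<longleftrightarrow>
     sat U (\<lambda>i. if i = 0 then x else if i \<in> I then y \<oplus> [m] \<cdot> x else e i) p"

lemma dfn_fibre_rel:
  assumes e: "range e \<subseteq> carrier U" and S: "\<And>i. i \<in> free_vars p - {0} - I \<Longrightarrow> e i \<in> S"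
  shows "dfn 2 S (\<lambda>w. fibre_rel m I e p (w 0) (w 1))"
proof -
  define t where "t = (\<lambda>i. if i = 0 then Var 0 else
    if i \<in> I then Add (Var 1) (nat_mult_tm m (Var 0)) else Var (i + 2))"
  show ?thesis
  proof (rule dfn_sat[of "\<lambda>j. e (j - 2)" p t])
    show "range (\<lambda>j. e (j - 2)) \<subseteq> carrier U" using e by auto
    show "e (j - 2) \<in> S" if "i \<in> free_vars p" "j \<in> tm_vars (t i)" "2 \<le> j" for i j
      using that S[of i] tm_vars_nat_mult[of m "Var 0"] by (auto simp: t_def split: if_splits)
    show "fibre_rel m I e p (w 0) (w 1) =
        sat U (\<lambda>i. tm_val U (\<lambda>j. if j < 2 then w j else e (j - 2)) (t i)) p" for w
      unfolding fibre_rel_def by (rule sat_cong) (auto simp: t_def tm_val_nat_mult)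
  qed
qed

lemma dfn_pair:
  assumes "dfn 1 S (\<lambda>w. w 0 \<in> H)"
  shows "dfn 2 S (\<lambda>w. w 0 \<in> H \<and> w 1 \<in> H)"
proof -
  obtain p e where p: "range e \<subseteq> carrier U" "\<forall>i\<in>free_vars p. 1 \<le> i \<longrightarrow> e i \<in> S"
    "\<forall>w. (\<forall>i<1. w i \<in> carrier U) \<longrightarrow> (w 0 \<in> H) = sat U (\<lambda>i. if i < 1 then w i else e i) p"
    by (rule dfnE[OF assms])
  have "dfn 2 S (\<lambda>w. w k \<in> H)" if k: "k < 2" for k
  proof (rule dfn_sat[of "\<lambda>j. e (j - 1)" p "\<lambda>i. Var (if i = 0 then k else i + 1)"])
    show "range (\<lambda>j. e (j - 1)) \<subseteq> carrier U" using p(1) by auto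
    show "e (j - 1) \<in> S"
      if "i \<in> free_vars p" "j \<in> tm_vars (Var (if i = 0 then k else i + 1))" "2 \<le> j" for i j
      using that p(2) k by (auto split: if_splits)
    fix w :: "nat \<Rightarrow> 'a" assume "\<And>i. i < 2 \<Longrightarrow> w i \<in> carrier U"
    then have "(w k \<in> H) = sat U (\<lambda>i. if i < 1 then w k else e i) p"
      using p(3)[rule_format, of "\<lambda>_. w k"] k by auto
    also have "\<dots> = sat U (\<lambda>i. tm_val U (\<lambda>j. if j < 2 then w j else e (j - 1))
        (Var (if i = 0 then k else i + 1))) p"
      by (rule sat_cong) (use k in auto)
    finally show "(w k \<in> H) = sat U (\<lambda>i. tm_val U (\<lambda>j. if j < 2 then w j else e (j - 1))
        (Var (if i = 0 then k else i + 1))) p" .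
  qed
  from dfn_conj[OF this[of 0] this[of 1]] show ?thesis by simp
qed

lemma ex_independent_pair:
  assumes sat: "saturated U" and S: "small U S" and H: "H \<subseteq> carrier U" "dfn 1 S (\<lambda>w. w 0 \<in> H)"
    and sub: "\<zero> \<in> H" "\<And>x y. x \<in> H \<Longrightarrow> y \<in> H \<Longrightarrow> x \<oplus> y \<in> H"
    and g: "g \<in> H" "g \<noteq> \<zero>"
  shows "\<exists>x\<in>H. \<exists>y\<in>H. \<forall>m::nat. x \<notin> macl (insert (y \<oplus> [m] \<cdot> x) S)"
proof -
  \<comment> \<open>Indexes all possible witnesses for \<open>x\<close> being in the closure of
    \<open>S\<close> and \<open>y \<oplus> [m] \<cdot> x\<close>, for all \<open>m\<close> at
    once.\<close>
  define T where "T = {(m :: nat, I, e, p, N :: nat). fin_fibres p N \<and> range e \<subseteq> carrier U \<and>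
    (\<forall>i\<in>free_vars p - {0} - I. e i \<in> S)}"
  define rel where "rel = (\<lambda>(m, I, e, p, N :: nat) x y. \<not> fibre_rel m I e p x y)"
  define Q where "Q = insert (\<lambda>x y. x \<in> H \<and> y \<in> H) (rel ` T)"
  have gc: "g \<in> carrier U" using g H by blast
  have gH: "[j] \<cdot> g \<in> H" for j :: nat
    by (induction j) (use sub g in auto)
  have "\<exists>x\<in>carrier U. \<exists>y\<in>carrier U. \<forall>R\<in>Q. R x y"
  proof (rule saturated_dfn_pair[OF sat S])
    fix R assume "R \<in> Q"
    then consider "R = (\<lambda>x y. x \<in> H \<and> y \<in> H)" | m I e p N where
      "(m, I, e, p, N) \<in> T" "R = (\<lambda>x y. \<not> fibre_rel m I e p x y)"
      unfolding Q_def rel_def by auto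
    then show "dfn 2 S (\<lambda>w. R (w 0) (w 1))"
    proof cases
      case 1
      then show ?thesis using dfn_pair[OF H(2)] by simp
    next
      case 2
      then show ?thesis using dfn_neg[OF dfn_fibre_rel[of e p I S m]] by (simp add: T_def)
    qed
  next
    fix F assume F: "finite F" "F \<subseteq> Q"
    have "finite (F - {\<lambda>x y. x \<in> H \<and> y \<in> H})" "F - {\<lambda>x y. x \<in> H \<and> y \<in> H} \<subseteq> rel ` T"
      using F by (auto simp: Q_def)
    from finite_subset_image[OF this] obtain L where
      L: "finite L" "L \<subseteq> T" "F - {\<lambda>x y. x \<in> H \<and> y \<in> H} = rel ` L" by blast
    \<comment> \<open>On the grid the varying element is again a multiple
      \<open>[t] \<cdot> g\<close>, so the conditions become statements about natural
      numbers.\<close>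
    define B where "B = (\<lambda>(m :: nat, I, e, p, N :: nat) j t.
      sat U (\<lambda>i. if i = 0 then [(j::nat)] \<cdot> g else if i \<in> I then [(t::nat)] \<cdot> g else e i) p)"
    have "\<exists>j j'. \<forall>l\<in>L. \<not> B l j (j' + fst l * j)"
    proof (rule ex_grid_point[OF L(1), where N = "\<lambda>(m, I, e, p, N). N"])
      fix l t assume "l \<in> L"
      then have lT: "l \<in> T" using L(2) by blast
      obtain m I e p N where l: "l = (m, I, e, p, N)" by (cases l)
      define w where "w = (\<lambda>i. if i \<in> I then [(t::nat)] \<cdot> g else e i)"
      define Z where "Z = {z \<in> carrier U. sat U (w(0 := z)) p}"
      have fin: "fin_fibres p N" and w: "range w \<subseteq> carrier U"
        using lT gc by (auto simp: T_def l w_def)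
      have eq: "w(0 := z) = (\<lambda>i. if i = 0 then z else if i \<in> I then [t] \<cdot> g else e i)" for z
        by (auto simp: w_def fun_eq_iff)
      have sub: "(\<lambda>j. [j] \<cdot> g) ` {j. B l j t} \<subseteq> Z"
        using gc by (auto simp: B_def l Z_def eq)
      \<comment> \<open>By characteristic zero distinct \<open>j\<close> give distinct multiples of
        \<open>g\<close>, so the bound on solutions bounds the number of \<open>j\<close>.\<close>
      have inj: "inj_on (\<lambda>j. [j] \<cdot> g) {j. B l j t}"
        using nat_mult_inj[OF gc g(2)] by (auto intro: inj_onI)
      have Z: "finite Z" "card Z \<le> N" using fin_fibresD[OF fin w] by (simp_all add: Z_def)
      have "finite {j. B l j t}" using inj_on_finite[OF inj sub Z(1)] .
      moreover have "card {j. B l j t} \<le> N" using card_inj_on_le[OF inj sub Z(1)] Z(2) by simp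
      ultimately show "finite {j. B l j t} \<and> card {j. B l j t} \<le> (case l of (m, I, e, p, N) \<Rightarrow> N)"
        by (simp add: l)
    qed
    then obtain j j' where jj: "\<forall>l\<in>L. \<not> B l j (j' + fst l * j)" by blast
    have lin: "[j'] \<cdot> g \<oplus> [m] \<cdot> ([j] \<cdot> g) = [(j' + m * j)] \<cdot> g" for m :: nat
      using gc by (simp add: add.nat_pow_mult add.nat_pow_pow mult.commute)
    have relL: "rel l ([j] \<cdot> g) ([j'] \<cdot> g)" if l: "l \<in> L" for l
    proof -
      obtain m I e p N where l': "l = (m, I, e, p, N)" by (cases l)
      show ?thesis using bspec[OF jj l] unfolding l' rel_def fibre_rel_def B_def split_conv fst_conv lin .
    qed
    have "R ([j] \<cdot> g) ([j'] \<cdot> g)" if R: "R \<in> F" for R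
    proof (cases "R = (\<lambda>x y. x \<in> H \<and> y \<in> H)")
      case True
      then show ?thesis using gH by simp
    next
      case False
      then have "R \<in> rel ` L" using L(3) R by blast
      then show ?thesis using relL by blast
    qed
    moreover have "[j] \<cdot> g \<in> carrier U" "[j'] \<cdot> g \<in> carrier U" using gc by auto
    ultimately show "\<exists>x\<in>carrier U. \<exists>y\<in>carrier U. \<forall>R\<in>F. R x y" by blast
  qed
  then obtain x y where xy: "x \<in> carrier U" "y \<in> carrier U" "\<forall>R\<in>Q. R x y" by blast
  have H': "x \<in> H" "y \<in> H" using xy(3) by (auto simp: Q_def)
  have "x \<notin> macl (insert (y \<oplus> [m] \<cdot> x) S)" for m :: nat
  proof
    assume "x \<in> macl (insert (y \<oplus> [m] \<cdot> x) S)"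
    then obtain p e N where p: "fin_fibres p N" "range e \<subseteq> carrier U"
      "\<forall>i\<in>free_vars p - {0}. e i \<in> insert (y \<oplus> [m] \<cdot> x) S" "sat U (e(0 := x)) p"
      unfolding macl_def by blast
    define I where "I = {i. e i = y \<oplus> [m] \<cdot> x}"
    have "(m, I, e, p, N) \<in> T" using p by (auto simp: T_def I_def)
    then have "rel (m, I, e, p, N) x y" using xy(3) unfolding Q_def by blast
    moreover have "e(0 := x) = (\<lambda>i. if i = 0 then x else if i \<in> I then y \<oplus> [m] \<cdot> x else e i)"
      by (auto simp: I_def fun_eq_iff)
    ultimately show False using p(4) by (simp add: rel_def fibre_rel_def)
  qed
  then show ?thesis using H' by blast
qed

text \<open>Existential quantification over the tuple yields its projection. This reduces tuples of
  \<open>G\<close> to single elements, to which the one-variable form of saturation applies.\<close>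

lemma dfn_coord:
  assumes A: "A \<subseteq> carrier U" and G: "definable_over U n A G" and k: "k < n"
  shows "dfn 1 A (\<lambda>w. w 0 \<in> (\<lambda>a. a k) ` G)"
proof -
  obtain p e where e: "\<forall>i\<in>free_vars p. i \<ge> n \<longrightarrow> e i \<in> A"
    and G_eq: "G = {x \<in> (\<Pi>\<^sub>E i\<in>{..<n}. carrier U). sat U (\<lambda>i. if i < n then x i else e i) p}"
    using G unfolding definable_over_def by blast
  \<comment> \<open>Parameters move up by one place to free variable \<open>0\<close> for the
    projected coordinate. The default \<open>\<zero>\<close> is there because
    \<open>definable_over\<close> does not confine the other values of \<open>e\<close> to the
    carrier.\<close>
  define f where "f = (\<lambda>j. if j - 1 \<in> free_vars p \<and> n < j then e (j - 1) else \<zero>)"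
  define p' where "p' = fm_subst p (\<lambda>i. Var (Suc i))"
  define q where "q = foldr Ex [1..<Suc n] (Conj p' (Eq (Var 0) (Var (Suc k))))"
  have fv: "free_vars q \<subseteq> insert 0 (Suc ` {i \<in> free_vars p. n \<le> i})"
    using free_vars_subst[of p "\<lambda>i. Var (Suc i)"] k
    unfolding q_def free_vars_Exs p'_def[symmetric] by fastforce
  have key: "w 0 \<in> (\<lambda>a. a k) ` G \<longleftrightarrow> sat U (\<lambda>i. if i < 1 then w i else f i) q" for w
  proof -
    have sat_eq: "sat U (\<lambda>i. if i \<in> set [1..<Suc n] then v i else if i < 1 then w i else f i) p' \<longleftrightarrow>
        sat U (\<lambda>i. if i < n then v (Suc i) else e i) p" for v
      unfolding p'_def sat_subst by (rule sat_cong) (auto simp: f_def)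
    show ?thesis
    proof
      assume "w 0 \<in> (\<lambda>a. a k) ` G"
      then obtain a where a: "a \<in> G" "w 0 = a k" by blast
      have s: "sat U (\<lambda>i. if i < n then a i else e i) p" and ac: "\<forall>i<n. a i \<in> carrier U"
        using a(1) by (auto simp: G_eq)
      define v where "v = (\<lambda>i. a (i - 1))"
      have "(\<lambda>i. if i < n then v (Suc i) else e i) = (\<lambda>i. if i < n then a i else e i)"
        by (auto simp: v_def)
      then have "sat U (\<lambda>i. if i \<in> set [1..<Suc n] then v i else if i < 1 then w i else f i)
          (Conj p' (Eq (Var 0) (Var (Suc k))))"
        using a(2) k s sat_eq[of v] by (auto simp: v_def)
      moreover have "\<forall>i\<in>set [1..<Suc n]. v i \<in> carrier U"
        using ac by (auto simp: v_def)
      ultimately show "sat U (\<lambda>i. if i < 1 then w i else f i) q"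
        unfolding q_def sat_Exs by blast
    next
      assume "sat U (\<lambda>i. if i < 1 then w i else f i) q"
      then obtain v where v: "\<forall>i\<in>set [1..<Suc n]. v i \<in> carrier U"
        and vs: "sat U (\<lambda>i. if i \<in> set [1..<Suc n] then v i else if i < 1 then w i else f i)
          (Conj p' (Eq (Var 0) (Var (Suc k))))"
        unfolding q_def sat_Exs by blast
      define a where "a = (\<lambda>i\<in>{..<n}. v (Suc i))"
      have "sat U (\<lambda>i. if i < n then v (Suc i) else e i) p" using vs sat_eq by simp
      then have "sat U (\<lambda>i. if i < n then a i else e i) p"
        by (rule sat_cong[THEN iffD1, rotated]) (auto simp: a_def)
      moreover have "a \<in> (\<Pi>\<^sub>E i\<in>{..<n}. carrier U)"
        using v by (auto simp: a_def simp del: upt_Suc)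
      ultimately have "a \<in> G" unfolding G_eq by blast
      moreover have "w 0 = a k" using vs k by (auto simp: a_def)
      ultimately show "w 0 \<in> (\<lambda>a. a k) ` G" by blast
    qed
  qed
  show ?thesis
    unfolding dfn_def
  proof (intro exI[of _ q] exI[of _ f] conjI ballI impI allI)
    show "range f \<subseteq> carrier U" using e A by (auto simp: f_def)
    show "f i \<in> A" if "i \<in> free_vars q" "1 \<le> i" for i
      using that fv e by (auto simp: f_def)
  qed (use key in auto)
qed

text \<open>The slope \<open>l\<close> behaves like an infinitely large natural number: its type is finitely satisfied
  by natural numbers.\<close>

lemma ex_generic_slope:
  assumes sat: "saturated U" and S: "small U S" and A: "A \<subseteq> S" and xy: "x \<in> S" "y \<in> S"
    and indep: "\<And>m::nat. x \<notin> macl (insert (y \<oplus> [m] \<cdot> x) A)"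
  shows "\<exists>l\<in>carrier U. l \<notin> macl S \<and> x \<notin> macl (insert l (insert (y \<oplus> l \<otimes> x) A))"
proof -
  have Sc: "S \<subseteq> carrier U" using S by (simp add: small_def)
  then have xyc: "x \<in> carrier U" "y \<in> carrier U" and Ac: "A \<subseteq> carrier U" using xy A by auto
  \<comment> \<open>\<open>I\<close> and \<open>J\<close> list the variables that stand for
    \<open>y \<oplus> l \<otimes> x\<close> and for \<open>l\<close>.\<close>
  define env where "env = (\<lambda>I J (e :: nat \<Rightarrow> 'a) l i.
    if i = 0 then x else if i \<in> I then y \<oplus> l \<otimes> x else if i \<in> J then l else e i)"
  \<comment> \<open>The first family keeps \<open>l\<close> outside \<open>macl S\<close>, the
    second keeps \<open>x\<close> outside the closure of \<open>A\<close>, \<open>l\<close> and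
    \<open>y \<oplus> l \<otimes> x\<close>.\<close>
  define Q where "Q = {(\<lambda>l. \<not> sat U (e(0 := l)) p) | e p N. fin_fibres p N \<and> range e \<subseteq> carrier U \<and>
      (\<forall>i\<in>free_vars p - {0}. e i \<in> S)} \<union>
    {(\<lambda>l. \<not> sat U (env I J e l) p) | I J e p N. fin_fibres p N \<and> range e \<subseteq> carrier U \<and>
      (\<forall>i\<in>free_vars p - {0} - I - J. e i \<in> A)}"
  have QE: thesis if "P \<in> Q"
    and "\<And>e p N. P = (\<lambda>l. \<not> sat U (e(0 := l)) p) \<Longrightarrow> fin_fibres p N \<Longrightarrow> range e \<subseteq> carrier U \<Longrightarrow>
      \<forall>i\<in>free_vars p - {0}. e i \<in> S \<Longrightarrow> thesis"
    and "\<And>I J e p N. P = (\<lambda>l. \<not> sat U (env I J e l) p) \<Longrightarrow> fin_fibres p N \<Longrightarrow> range e \<subseteq> carrier U \<Longrightarrow>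
      \<forall>i\<in>free_vars p - {0} - I - J. e i \<in> A \<Longrightarrow> thesis" for P thesis
    using that(1) unfolding Q_def
  proof (elim UnE CollectE exE conjE)
  qed (rule that(2) that(3); assumption)+
  have def: "dfn 1 S (\<lambda>w. P (w 0))" if "P \<in> Q" for P
    using that
  proof (rule QE)
    fix e p N
    assume P: "P = (\<lambda>l. \<not> sat U (e(0 := l)) p)" and e: "range e \<subseteq> carrier U" "\<forall>i\<in>free_vars p - {0}. e i \<in> S"
    have "dfn 1 S (\<lambda>w. sat U (e(0 := w 0)) p)"
      by (rule dfn_sat[of e p Var]) (use e in \<open>auto intro!: sat_cong\<close>)
    from dfn_neg[OF this] show ?thesis by (simp add: P)
  next
    fix I J e p N
    assume P: "P = (\<lambda>l. \<not> sat U (env I J e l) p)" and e: "range e \<subseteq> carrier U"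
      "\<forall>i\<in>free_vars p - {0} - I - J. e i \<in> A"
    define t where "t = (\<lambda>i. if i = 0 then Var 1 else if i \<in> I then Add (Var 2) (Mult (Var 0) (Var 1))
      else if i \<in> J then Var 0 else Var (i + 3))"
    define f where "f = (\<lambda>j. if j = 1 then x else if j = 2 then y else e (j - 3))"
    have "dfn 1 S (\<lambda>w. sat U (env I J e (w 0)) p)"
    proof (rule dfn_sat[of f p t])
      show "range f \<subseteq> carrier U" using e xyc by (auto simp: f_def)
      show "f j \<in> S" if "i \<in> free_vars p" "j \<in> tm_vars (t i)" "1 \<le> j" for i j
        using that e A xy by (auto simp: f_def t_def split: if_splits)
      show "sat U (env I J e (w 0)) p = sat U (\<lambda>i. tm_val U (\<lambda>j. if j < 1 then w j else f j) (t i)) p" for w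
        by (rule sat_cong) (auto simp: env_def t_def f_def)
    qed
    from dfn_neg[OF this] show ?thesis by (simp add: P)
  qed
  \<comment> \<open>A condition of the first family excludes finitely many elements. One of the
    second cannot fail at \<open>[m] \<cdot> \<one>\<close>: this element lies in every closure, so
    a failure would put \<open>x\<close> into the closure of \<open>A\<close> and
    \<open>y \<oplus> [m] \<cdot> x\<close>.\<close>
  have cofinite: "finite {m::nat. \<not> P ([m] \<cdot> \<one>)}" if "P \<in> Q" for P
    using that
  proof (rule QE)
    fix e p N
    assume P: "P = (\<lambda>l. \<not> sat U (e(0 := l)) p)" and p: "fin_fibres p N" "range e \<subseteq> carrier U"
    have sub: "(\<lambda>m::nat. [m] \<cdot> \<one>) ` {m. \<not> P ([m] \<cdot> \<one>)} \<subseteq> {z \<in> carrier U. sat U (e(0 := z)) p}"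
      by (auto simp: P)
    have "inj_on (\<lambda>m::nat. [m] \<cdot> \<one>) {m. \<not> P ([m] \<cdot> \<one>)}"
      using nat_mult_inj[of \<one>] by (auto intro!: inj_onI)
    then show ?thesis
      using inj_on_finite[OF _ sub fin_fibresD(1)[OF p]] by blast
  next
    fix I J e p N
    assume P: "P = (\<lambda>l. \<not> sat U (env I J e l) p)" and p: "fin_fibres p N" "range e \<subseteq> carrier U"
      "\<forall>i\<in>free_vars p - {0} - I - J. e i \<in> A"
    have "P ([m] \<cdot> \<one>)" for m :: nat
    proof (rule ccontr)
      assume "\<not> P ([m] \<cdot> \<one>)"
      then have s: "sat U (env I J e ([m] \<cdot> \<one>)) p" by (simp add: P)
      let ?S = "insert (y \<oplus> [m] \<cdot> x) A"
      define w where "w = (env I J e ([m] \<cdot> \<one>))(0 := \<zero>)"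
      have mx: "[m] \<cdot> \<one> \<otimes> x = [m] \<cdot> x" using xyc add_pow_ldistr[of \<one> x m] by simp
      have "?S \<subseteq> macl ?S" using xyc Ac by (intro subset_macl) auto
      moreover have "[k] \<cdot> \<one> \<in> macl ?S" for k :: nat by (induction k) (auto simp: macl_closed)
      ultimately have "w i \<in> macl ?S" if "i \<in> free_vars p" "i \<noteq> 0" for i
        using that p(3) by (auto simp: w_def env_def mx)
      moreover have "range w \<subseteq> carrier U" using p(2) xyc by (auto simp: w_def env_def)
      moreover have "w(0 := x) = env I J e ([m] \<cdot> \<one>)" by (auto simp: w_def env_def fun_eq_iff)
      then have "sat U (w(0 := x)) p" using s by simp
      ultimately have "x \<in> macl ?S"
        using macl_idem_witness[OF xyc(1) p(1), of w ?S] by blast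
      then show False using indep by blast
    qed
    then show ?thesis by simp
  qed
  have "\<exists>l\<in>carrier U. \<forall>P\<in>Q. P l"
  proof (rule saturated_dfn[OF sat S def])
    fix F assume F: "finite F" "F \<subseteq> Q"
    have "finite (\<Union>P\<in>F. {m::nat. \<not> P ([m] \<cdot> \<one>)})" using F cofinite by auto
    then obtain m where "m \<notin> (\<Union>P\<in>F. {m::nat. \<not> P ([m] \<cdot> \<one>)})"
      using ex_new_if_finite[OF infinite_UNIV_nat] by blast
    then show "\<exists>x\<in>carrier U. \<forall>P\<in>F. P x"
      by (intro bexI[of _ "[m] \<cdot> \<one>"]) auto
  qed
  then obtain l where l: "l \<in> carrier U" "\<forall>P\<in>Q. P l" ..
  have "l \<notin> macl S"
  proof
    assume "l \<in> macl S"
    then obtain p e N where p: "fin_fibres p N" "range e \<subseteq> carrier U"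
      "\<forall>i\<in>free_vars p - {0}. e i \<in> S" "sat U (e(0 := l)) p"
      unfolding macl_def by blast
    then have "(\<lambda>l. \<not> sat U (e(0 := l)) p) \<in> Q" unfolding Q_def by blast
    from bspec[OF l(2) this] show False using p(4) by simp
  qed
  moreover have "x \<notin> macl (insert l (insert (y \<oplus> l \<otimes> x) A))"
  proof
    assume "x \<in> macl (insert l (insert (y \<oplus> l \<otimes> x) A))"
    then obtain p e N where p: "fin_fibres p N" "range e \<subseteq> carrier U"
      "\<forall>i\<in>free_vars p - {0}. e i \<in> insert l (insert (y \<oplus> l \<otimes> x) A)" "sat U (e(0 := x)) p"
      unfolding macl_def by blast
    define I where "I = {i. e i = y \<oplus> l \<otimes> x}"
    define J where "J = {i. e i = l}"
    have "\<forall>i\<in>free_vars p - {0} - I - J. e i \<in> A" using p(3) by (auto simp: I_def J_def)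
    then have "(\<lambda>l. \<not> sat U (env I J e l) p) \<in> Q" unfolding Q_def using p(1,2) by blast
    from bspec[OF l(2) this] have "\<not> sat U (env I J e l) p" by simp
    moreover have "env I J e l = e(0 := x)"
      by (auto simp: env_def I_def J_def fun_eq_iff)
    ultimately show False using p(4) by simp
  qed
  ultimately show ?thesis using l(1) by blast
qed

text \<open>Two lines through \<open>(x, y)\<close> are compared:
  \<open>y \<oplus> l \<otimes> x = c\<close>, defined over \<open>B\<close>, and one with
  coefficients in \<open>acl U C\<close> that linear disjointness provides. If they differ,
  \<open>x\<close> is computed from \<open>B\<close>; if they agree, \<open>l\<close> is computed
  from \<open>A\<close> and the coordinates of \<open>a\<close> and \<open>b\<close>.\<close>

lemma definable_subgroup_not_one_based:
  assumes sat: "saturated U" and A: "small U A" and def: "definable_over U n A G"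
    and sub: "subgroup G (Ga U n)" and inf: "infinite G"
  shows "\<not> one_based U n A G"
proof
  assume one: "one_based U n A G"
  have Ac: "A \<subseteq> carrier U" using A by (simp add: small_def)
  have GPi: "G \<subseteq> (\<Pi>\<^sub>E i\<in>{..<n}. carrier U)"
    using subgroup.subset[OF sub] by (simp add: Ga_def)
  have zero_G: "(\<lambda>i\<in>{..<n}. \<zero>) \<in> G"
    using subgroup.one_closed[OF sub] by (simp add: Ga_def)
  have add_G: "(\<lambda>i\<in>{..<n}. a i \<oplus> b i) \<in> G" if "a \<in> G" "b \<in> G" for a b
    using subgroup.m_closed[OF sub that] by (simp add: Ga_def)
  have "\<not> G \<subseteq> {\<lambda>i\<in>{..<n}. \<zero>}" using inf finite_subset by blast
  then obtain g where g: "g \<in> G" "g \<noteq> (\<lambda>i\<in>{..<n}. \<zero>)" by blast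
  then obtain k where k: "k < n" "g k \<noteq> \<zero>"
    using GPi PiE_ext[of g "{..<n}" "\<lambda>_. carrier U" "\<lambda>i\<in>{..<n}. \<zero>"] by fastforce
  let ?H = "(\<lambda>a. a k) ` G"
  have Hc: "?H \<subseteq> carrier U" using GPi k by auto
  have H0: "\<zero> \<in> ?H" using zero_G k(1) by (intro image_eqI[of _ _ "\<lambda>i\<in>{..<n}. \<zero>"]) auto
  have Hadd: "x \<oplus> y \<in> ?H" if "x \<in> ?H" "y \<in> ?H" for x y
  proof -
    obtain a b where ab: "a \<in> G" "b \<in> G" "x = a k" "y = b k" using \<open>x \<in> ?H\<close> \<open>y \<in> ?H\<close> by blast
    then show ?thesis using add_G[OF ab(1,2)] k(1) by (intro image_eqI[of _ _ "\<lambda>i\<in>{..<n}. a i \<oplus> b i"]) auto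
  qed
  have "g k \<in> ?H" using g by blast
  from ex_independent_pair[OF sat A Hc dfn_coord[OF Ac def k(1)] H0 Hadd this k(2)]
  obtain x y where "x \<in> ?H" "y \<in> ?H"
    and indep: "\<And>m::nat. x \<notin> macl (insert (y \<oplus> [m] \<cdot> x) A)" by blast
  then obtain a b where ab: "a \<in> G" "b \<in> G" and x: "x = a k" and y: "y = b k" by blast
  \<comment> \<open>1-basedness involves all coordinates of \<open>a\<close> and \<open>b\<close>,
    so \<open>l\<close> has to avoid the closure of all of them, not only that of \<open>x\<close>
    and \<open>y\<close>.\<close>
  define T where "T = coords n [a, b]"
  have T: "finite T" "T \<subseteq> carrier U" "x \<in> T" "y \<in> T"
    using ab GPi k(1) by (auto simp: T_def coords_def x y)
  then have xyc: "x \<in> carrier U" "y \<in> carrier U" by auto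
  obtain l where l: "l \<in> carrier U" "l \<notin> macl (A \<union> T)"
    and xl: "x \<notin> macl (insert l (insert (y \<oplus> l \<otimes> x) A))"
    using ex_generic_slope[OF sat small_Un_finite[OF T(1) A T(2)] Un_upper1 _ _ indep] T(3,4) by blast
  define c where "c = y \<oplus> l \<otimes> x"
  define B where "B = insert l (insert c A)"
  have cc: "c \<in> carrier U" using l(1) xyc by (simp add: c_def)
  have B: "small U B" "A \<subseteq> B" "B \<subseteq> carrier U"
    unfolding B_def using small_insert[OF small_insert[OF A cc] l(1)] Ac cc l(1) by auto
  define C where "C = acl U (A \<union> T) \<inter> acl U B"
  have Cc: "C \<subseteq> carrier U" using acl_carrier by (auto simp: C_def)
  have ld: "linearly_disjoint U (acl U C) (acl U (T \<union> C)) (acl U (B \<union> C))"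
    using one B(1,2) ab unfolding one_based_def indep_over_def C_def T_def by auto
  \<comment> \<open>Coefficients from \<open>acl U C\<close> may thus be used on either side: over
    \<open>A \<union> T\<close> to compute \<open>l\<close>, over \<open>B\<close> to compute
    \<open>x\<close>.\<close>
  have CA: "acl U C \<subseteq> macl (A \<union> T)" and CB: "acl U C \<subseteq> macl B"
  proof -
    have "C \<subseteq> macl (A \<union> T)" "C \<subseteq> macl B"
      using acl_macl[of "A \<union> T"] acl_macl[of B] Ac T B(3) by (auto simp: C_def)
    then show "acl U C \<subseteq> macl (A \<union> T)" "acl U C \<subseteq> macl B"
      using acl_macl[OF Cc] macl_trans by blast+
  qed
  have KC: "subfield (acl U C) U" and KB: "subfield (acl U (B \<union> C)) U"
    using acl_subfield Cc B(3) by auto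
  have xs: "set [x, y, \<one>] \<subseteq> acl U (T \<union> C)"
    using subset_acl[of "T \<union> C"] T Cc acl_subfield[of "T \<union> C"] subringE(3)[OF subfieldE(1)]
    by auto
  \<comment> \<open>The equation of the first line is a linear relation between \<open>x\<close>,
    \<open>y\<close> and \<open>\<one>\<close>; it is nontrivial because \<open>y\<close> has
    coefficient \<open>\<one>\<close>.\<close>
  have "dependent (acl U (B \<union> C)) [x, y, \<one>]"
  proof (rule non_trivial_combine_imp_dependent[OF KB])
    have "B \<subseteq> acl U (B \<union> C)" using subset_acl[of "B \<union> C"] B(3) Cc by auto
    then have "l \<in> acl U (B \<union> C)" "c \<in> acl U (B \<union> C)" by (auto simp: B_def)
    then show "set [l, \<one>, \<ominus> c] \<subseteq> acl U (B \<union> C)"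
      using subringE(3,5)[OF subfieldE(1)[OF KB]] by auto
    have "l \<otimes> x \<oplus> (y \<oplus> \<ominus> c) = \<zero>"
      using l(1) xyc unfolding c_def by algebra
    then show "combine [l, \<one>, \<ominus> c] [x, y, \<one>] = \<zero>"
      using l(1) xyc cc by simp
  qed auto
  then have "dependent (acl U C) [x, y, \<one>]"
    using ld xs unfolding linearly_disjoint_def by blast
  then obtain Ks where Ks: "length Ks = length [x, y, \<one>]" "combine Ks [x, y, \<one>] = \<zero>"
    "set Ks \<subseteq> acl U C" "set Ks \<noteq> {\<zero>}"
    using dependent_imp_non_trivial_combine[OF KC, of "[x, y, \<one>]"] xyc by auto
  then obtain u v w where uvw: "Ks = [u, v, w]"
    by (auto simp: length_Suc_conv)
  have KA: "u \<in> macl (A \<union> T)" "v \<in> macl (A \<union> T)" and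
    K: "u \<in> macl B" "v \<in> macl B" "w \<in> macl B"
    using Ks(3) CA CB by (auto simp: uvw)
  have car: "u \<in> carrier U" "v \<in> carrier U" "w \<in> carrier U" using K macl_carrier by auto
  have rel: "u \<otimes> x \<oplus> v \<otimes> y \<oplus> w = \<zero>"
    using Ks(2) car xyc by (simp add: uvw a_assoc)
  have lcB: "l \<in> macl B" "c \<in> macl B" using subset_macl[OF B(3)] by (auto simp: B_def)
  \<comment> \<open>Eliminating \<open>y\<close> from the two equations leaves a linear equation for
    \<open>x\<close> over \<open>B\<close> with leading coefficient \<open>d\<close>.\<close>
  define d where "d = u \<ominus> v \<otimes> l"
  have d: "d \<in> macl B" "d \<in> carrier U"
    using K lcB macl_carrier by (auto simp: d_def a_minus_def macl_closed car l(1))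
  have lin: "d \<otimes> x \<oplus> (v \<otimes> c \<oplus> w) = \<zero>"
  proof -
    have "d \<otimes> x \<oplus> (v \<otimes> c \<oplus> w) = u \<otimes> x \<oplus> v \<otimes> y \<oplus> w"
      unfolding d_def c_def using car xyc l(1) by algebra
    then show ?thesis using rel by simp
  qed
  have "d = \<zero>"
  proof (rule ccontr)
    assume d0: "d \<noteq> \<zero>"
    then have du: "d \<in> Units U" using d field_Units by auto
    have "inv d \<in> macl B" using subfield_m_inv(1)[OF macl_subfield] d d0 by auto
    moreover have "d \<otimes> x = \<ominus> (v \<otimes> c \<oplus> w)"
      using lin d car xyc cc by (simp add: sum_zero_eq_neg)
    then have "x = inv d \<otimes> \<ominus> (v \<otimes> c \<oplus> w)"
      using du d xyc by (metis Units_inv_closed Units_l_inv l_one m_assoc)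
    ultimately have "x \<in> macl B" using K lcB by (auto simp: macl_closed)
    then show False using xl by (simp add: B_def c_def)
  qed
  then have u: "u = v \<otimes> l" using car l(1) by (simp add: d_def)
  \<comment> \<open>Since \<open>d\<close> vanishes, \<open>v = \<zero>\<close> would make all three
    coefficients of the second line vanish.\<close>
  have "v \<noteq> \<zero>"
  proof
    assume v: "v = \<zero>"
    then have "w = \<zero>" using lin u car xyc cc l(1) by (simp add: d_def a_minus_def)
    then show False using Ks(4) u v l(1) by (simp add: uvw)
  qed
  then have "v \<in> Units U" using car field_Units by auto
  then have "l = inv v \<otimes> u" using u car l(1) by (metis Units_inv_closed Units_l_inv l_one m_assoc)
  moreover have "inv v \<in> macl (A \<union> T)"
    using subfield_m_inv(1)[OF macl_subfield] KA(2) \<open>v \<noteq> \<zero>\<close> by auto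
  ultimately have "l \<in> macl (A \<union> T)" using KA(1) by (simp add: macl_closed)
  then show False using l(2) by simp
qed

end


theorem proposition4p1:
  fixes U :: "'a dd_struct" and n :: nat and A :: "'a set" and G :: "(nat \<Rightarrow> 'a) set"
  assumes "DCFA_model U" and "saturated U" and "n \<ge> 1"
    and "small U A" and "definable_over U n A G"
    and "subgroup G (Ga U n)" and "infinite G"
  shows "\<not> one_based U n A G"
proof -
  interpret dd_fld U
    by unfold_locales (rule DCFA_model_dd_field[OF assms(1)])
  show ?thesis
    by (rule definable_subgroup_not_one_based[OF assms(2,4-7)])
qed

end
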